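(* Let $\|\mathbf f\|_1=\int|\mathbf f(\mathbf X_{j:k})|\,\delta\mathbf X_{j:k}$ denote the $L_1$-norm of $\mathbf f:\mathcal F(\mathbb X\times\mathbb L_j)\times\cdots\times\mathcal F(\mathbb X\times\mathbb L_k)\to\mathbb R$. For $\mathbb H\subseteq\Xi\times\mathcal F(\mathbb L_j)\times\cdots\times\mathcal F(\mathbb L_k)$ let $$\mathbf f_{\mathbb H}(\mathbf X_{j:k})=\Delta(\mathbf X_{j:k})\sum_{(\xi,I_{j:k})\in\mathbb H}w^{(\xi)}(I_{j:k})\,\delta_{I_{j:k}}[\mathcal L(\mathbf X_{j:k})]\,\big[p^{(\xi)}\big]^{\mathbf X_{j:k}}$$ be a multi-scan GLMB density with unnormalized (non-negative) weights. If $\mathbb T\subseteq\mathbb H$, then $$\|\mathbf f_{\mathbb H}-\mathbf f_{\mathbb T}\|_1=\sum_{(\xi,I_{j:k})\in\mathbb H-\mathbb T}w^{(\xi)}(I_{j:k}),$$ $$\left\|\frac{\mathbf f_{\mathbb H}}{\|\mathbf f_{\mathbb H}\|_1}-\frac{\mathbf f_{\mathbb T}}{\|\mathbf f_{\mathbb T}\|_1}\right\|_1\le 2\,\frac{\|\mathbf f_{\mathbb H}\|_1-\|\mathbf f_{\mathbb T}\|_1}{\|\mathbf f_{\mathbb H}\|_1}.$$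
   Context: $j\le k$ are time indices. $\mathbb X$ is the single-object state space (with reference measure $dx$, e.g. $\mathbb R^d$ with Lebesgue measure). $\mathbb B_s$ is the finite set of labels $\ell=(s,\alpha)$ of objects born at time $s$; $\mathbb L_i=\biguplus_{s=0}^i\mathbb B_s$. $\mathcal F(S)$ is the class of finite subsets of $S$; $1_S$ is the indicator of $S$; $\delta_Y[X]=1$ if $X=Y$, else $0$; $X_{m:n}$ abbreviates $X_m,\dots,X_n$. For a finite set $\mathbf X\subset\mathbb X\times\mathbb L_i$, $\mathcal L(\mathbf X)$ is the set of its labels and $\Delta(\mathbf X)=\delta_{|\mathbf X|}[|\mathcal L(\mathbf X)|]$ is the distinct label indicator. $\Delta(\mathbf X_{j:k})=\prod_{i=j}^k\Delta(\mathbf X_i)$, $\mathcal L(\mathbf X_{j:k})=[\mathcal L(\mathbf X_j),\dots,\mathcal L(\mathbf X_k)]$. Let $\mathbf x_i^{(\ell)}=(x_i^{(\ell)},\ell)$ be the element of $\mathbf X_i$ with label $\ell$. For $\ell=(b,\alpha)\in\bigcup_{i=j}^k\mathcal L(\mathbf X_i)$, $s(\ell)=\max\{j,b\}$, $t(\ell)=s(\ell)+\sum_{i=s(\ell)+1}^k1_{\mathcal L(\mathbf X_i)}(\ell)$; sequences are understood to represent sets of trajectories, i.e. each such $\ell$ is present exactly at times $s(\ell),\dots,t(\ell)$ (weights of label sequences violating this are $0$ and the corresponding terms are $0$). For a function $h$ of trajectories $\mathbf x_{s(\ell):t(\ell)}^{(\ell)}=[(x_{s(\ell)}^{(\ell)},\ell),\dots,(x_{t(\ell)}^{(\ell)},\ell)]$,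 also written $h(x_{s(\ell):t(\ell)}^{(\ell)};\ell)$, the multi-scan exponential is $[h]^{\mathbf X_{j:k}}=\prod_{\ell\in\bigcup_{i=j}^k\mathcal L(\mathbf X_i)}h(\mathbf x_{s(\ell):t(\ell)}^{(\ell)})$. $\Xi$ is a discrete index set; $w^{(\xi)}(I_{j:k})\ge0$ for $\xi\in\Xi$, $I_{j:k}\in\mathcal F(\mathbb L_j)\times\cdots\times\mathcal F(\mathbb L_k)$; each $p^{(\xi)}(\cdot;\ell)$ is a probability density on $\mathbb X^{t(\ell)-s(\ell)+1}$ (for each possible trajectory length). The set integral of $f:\mathcal F(\mathbb X\times\mathbb L)\to\mathbb R$ is $\int f(\mathbf X)\delta\mathbf X=\sum_{n\ge0}\frac1{n!}\sum_{(\ell_1,\dots,\ell_n)\in\mathbb L^n}\int_{\mathbb X^n}f(\{(x_1,\ell_1),\dots,(x_n,\ell_n)\})dx_{1:n}$, and $\int\cdot\,\delta\mathbf X_{j:k}$ is the iterated set integral over $\mathbf X_j,\dots,\mathbf X_k$. In the second inequality the norms $\|\mathbf f_{\mathbb H}\|_1,\|\mathbf f_{\mathbb T}\|_1$ are finite and nonzero.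
   Formalization: The reference measure dx is assumed sigma-finite and without atoms (null diagonal), since with atoms repeated tuples collapse and the identity fails (one-point space gives e−1 instead of 1); the series for f_H is assumed convergent almost everywhere, and Ξ countable. *)

theory Defs
  imports "HOL-Probability.Probability"
begin

type_synonym 'b label = "nat \<times> 'b"

definition label_space :: "(nat \<Rightarrow> 'b label set) \<Rightarrow> nat \<Rightarrow> 'b label set" where
  "label_space B i = (\<Union>s\<le>i. B s)"

definition labels :: "('a \<times> 'b label) set \<Rightarrow> 'b label set" where
  "labels X = snd ` X"

definition distinct_labels :: "('a \<times> 'b label) set \<Rightarrow> real" where
  "distinct_labels X = of_bool (card (labels X) = card X)"

(* A sequence X_j, ..., X_k is a function on nat of which only the values on {j..k} matter;
   label sequences are taken extensional on {j..k}, so that they can be compared by =. *)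

definition label_seqs ::
  "nat \<Rightarrow> nat \<Rightarrow> (nat \<Rightarrow> 'b label set) \<Rightarrow> (nat \<Rightarrow> 'b label set) set" where
  "label_seqs j k B = (\<Pi>\<^sub>E i\<in>{j..k}. Fpow (label_space B i))"

definition ms_distinct_labels :: "nat \<Rightarrow> nat \<Rightarrow> (nat \<Rightarrow> ('a \<times> 'b label) set) \<Rightarrow> real" where
  "ms_distinct_labels j k X = (\<Prod>i=j..k. distinct_labels (X i))"

definition ms_labels ::
  "nat \<Rightarrow> nat \<Rightarrow> (nat \<Rightarrow> ('a \<times> 'b label) set) \<Rightarrow> nat \<Rightarrow> 'b label set" where
  "ms_labels j k X = (\<lambda>i\<in>{j..k}. labels (X i))"

definition traj_start :: "nat \<Rightarrow> 'b label \<Rightarrow> nat" where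
  "traj_start j l = max j (fst l)"

definition traj_end :: "nat \<Rightarrow> nat \<Rightarrow> (nat \<Rightarrow> 'b label set) \<Rightarrow> 'b label \<Rightarrow> nat" where
  "traj_end j k I l = traj_start j l + (\<Sum>i=Suc (traj_start j l)..k. of_bool (l \<in> I i))"

definition trajectory_labels :: "nat \<Rightarrow> nat \<Rightarrow> (nat \<Rightarrow> 'b label set) \<Rightarrow> bool" where
  "trajectory_labels j k I \<longleftrightarrow>
     (\<forall>l\<in>(\<Union>i\<in>{j..k}. I i). \<forall>i\<in>{j..k}. l \<in> I i \<longleftrightarrow> i \<in> {traj_start j l..traj_end j k I l})"

(* Meaningful when X has exactly one element with label l. *)
definition state_of :: "('a \<times> 'b label) set \<Rightarrow> 'b label \<Rightarrow> 'a" where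
  "state_of X l = (THE x. (x, l) \<in> X)"

definition trajectory ::
  "nat \<Rightarrow> nat \<Rightarrow> (nat \<Rightarrow> ('a \<times> 'b label) set) \<Rightarrow> 'b label \<Rightarrow> ('a \<times> 'b label) list" where
  "trajectory j k X l =
     map (\<lambda>i. (state_of (X i) l, l)) [traj_start j l..<Suc (traj_end j k (ms_labels j k X) l)]"

definition ms_exp ::
  "nat \<Rightarrow> nat \<Rightarrow> (('a \<times> 'b label) list \<Rightarrow> real) \<Rightarrow> (nat \<Rightarrow> ('a \<times> 'b label) set) \<Rightarrow> real" where
  "ms_exp j k h X = (\<Prod>l\<in>(\<Union>i\<in>{j..k}. labels (X i)). h (trajectory j k X l))"

definition prob_density :: "'c measure \<Rightarrow> ('c \<Rightarrow> real) \<Rightarrow> bool" where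
  "prob_density N f \<longleftrightarrow>
     f \<in> borel_measurable N \<and> (\<forall>x\<in>space N. 0 \<le> f x) \<and> (\<integral>\<^sup>+x. ennreal (f x) \<partial>N) = 1"

(* The set integral of a non-negative function, with values in [0, \<infinity>].  The index set
   {..<n} \<rightarrow>\<^sub>E L is the set of n-tuples of labels, so L has to be finite. *)
definition set_nn_integral ::
  "'a measure \<Rightarrow> 'b label set \<Rightarrow> (('a \<times> 'b label) set \<Rightarrow> ennreal) \<Rightarrow> ennreal" where
  "set_nn_integral M L f =
     (\<Sum>n. (\<Sum>l\<in>{..<n} \<rightarrow>\<^sub>E L.
             \<integral>\<^sup>+x. f ((\<lambda>i. (x i, l i)) ` {..<n}) \<partial>(\<Pi>\<^sub>M i\<in>{..<n}. M)) / fact n)"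

primrec iter_set_nn_integral ::
  "'a measure \<Rightarrow> (nat \<Rightarrow> 'b label set) \<Rightarrow> nat list \<Rightarrow>
   ((nat \<Rightarrow> ('a \<times> 'b label) set) \<Rightarrow> ennreal) \<Rightarrow> ennreal" where
  "iter_set_nn_integral M L [] f = f (\<lambda>_. undefined)"
| "iter_set_nn_integral M L (i # is) f =
     set_nn_integral M (L i) (\<lambda>Y. iter_set_nn_integral M L is (\<lambda>X. f (X(i := Y))))"

definition ms_nn_integral ::
  "'a measure \<Rightarrow> (nat \<Rightarrow> 'b label set) \<Rightarrow> nat \<Rightarrow> nat \<Rightarrow>
   ((nat \<Rightarrow> ('a \<times> 'b label) set) \<Rightarrow> ennreal) \<Rightarrow> ennreal" where
  "ms_nn_integral M B j k f = iter_set_nn_integral M (label_space B) [j..<Suc k] f"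

definition ms_L1_norm ::
  "'a measure \<Rightarrow> (nat \<Rightarrow> 'b label set) \<Rightarrow> nat \<Rightarrow> nat \<Rightarrow>
   ((nat \<Rightarrow> ('a \<times> 'b label) set) \<Rightarrow> real) \<Rightarrow> ennreal" where
  "ms_L1_norm M B j k f = ms_nn_integral M B j k (\<lambda>X. ennreal \<bar>f X\<bar>)"

definition ms_GLMB_term ::
  "nat \<Rightarrow> nat \<Rightarrow> ('xi \<Rightarrow> (nat \<Rightarrow> 'b label set) \<Rightarrow> real) \<Rightarrow>
   ('xi \<Rightarrow> ('a \<times> 'b label) list \<Rightarrow> real) \<Rightarrow>
   (nat \<Rightarrow> ('a \<times> 'b label) set) \<Rightarrow> 'xi \<times> (nat \<Rightarrow> 'b label set) \<Rightarrow> real" where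
  "ms_GLMB_term j k w p X =
     (\<lambda>(\<xi>, I). w \<xi> I * of_bool (ms_labels j k X = I) * ms_exp j k (p \<xi>) X)"

definition ms_GLMB ::
  "nat \<Rightarrow> nat \<Rightarrow> ('xi \<Rightarrow> (nat \<Rightarrow> 'b label set) \<Rightarrow> real) \<Rightarrow>
   ('xi \<Rightarrow> ('a \<times> 'b label) list \<Rightarrow> real) \<Rightarrow> ('xi \<times> (nat \<Rightarrow> 'b label set)) set \<Rightarrow>
   (nat \<Rightarrow> ('a \<times> 'b label) set) \<Rightarrow> real" where
  "ms_GLMB j k w p H X =
     ms_distinct_labels j k X * (\<Sum>\<^sub>\<infinity>h\<in>H. ms_GLMB_term j k w p X h)"

(* An infinite sum of reals that does not converge has value 0; this condition says that the
   series defining ms_GLMB converges for almost every X with distinct labels (the other X do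
   not contribute).  It holds for finite H, and whenever the weights are summable over H. *)
definition ms_GLMB_converges ::
  "'a measure \<Rightarrow> (nat \<Rightarrow> 'b label set) \<Rightarrow> nat \<Rightarrow> nat \<Rightarrow>
   ('xi \<Rightarrow> (nat \<Rightarrow> 'b label set) \<Rightarrow> real) \<Rightarrow> ('xi \<Rightarrow> ('a \<times> 'b label) list \<Rightarrow> real) \<Rightarrow>
   ('xi \<times> (nat \<Rightarrow> 'b label set)) set \<Rightarrow> bool" where
  "ms_GLMB_converges M B j k w p H \<longleftrightarrow>
     ms_nn_integral M B j k
       (\<lambda>X. of_bool (ms_distinct_labels j k X = 1 \<and> \<not> ms_GLMB_term j k w p X summable_on H)) = 0"

(* Without atoms: otherwise a tuple that repeats a labelled state would contribute to the set
   integral with positive measure although it collapses to a smaller set. *)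
definition diffuse :: "'a measure \<Rightarrow> bool" where
  "diffuse M \<longleftrightarrow> {z \<in> space (M \<Otimes>\<^sub>M M). fst z = snd z} \<in> null_sets (M \<Otimes>\<^sub>M M)"

lemma diffuse_lborel: "diffuse (lborel :: 'a :: euclidean_space measure)"
proof -
  let ?D = "{z \<in> space (lborel \<Otimes>\<^sub>M lborel). fst z = (snd z :: 'a)}"
  have D: "?D \<in> sets (lborel \<Otimes>\<^sub>M lborel)"
    by measurable
  have "emeasure (lborel \<Otimes>\<^sub>M lborel) ?D = (\<integral>\<^sup>+x. emeasure lborel (Pair x -` ?D) \<partial>lborel)"
    by (rule lborel.emeasure_pair_measure_alt[OF D])
  also have "\<dots> = (\<integral>\<^sup>+x. emeasure lborel {x :: 'a} \<partial>lborel)"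
    by (intro nn_integral_cong arg_cong2[where f = emeasure])
       (auto simp: space_pair_measure)
  also have "\<dots> = 0"
    by simp
  finally show ?thesis
    using D by (simp add: diffuse_def null_sets_def)
qed

end

theory Submission imports Defs begin

text \<open>
  On tuples of labelled states, the distinct label indicator kills (up to a null set, as the reference
  measure is diffuse) every tuple with a repeated label, and each set \<open>J\<close> of labels is listed by
  exactly \<open>card J!\<close> injective tuples.  So the set integral of a function supported on distinct
  labels is a finite sum over label sets \<open>J\<close> of ordinary integrals over states indexed by \<open>J\<close>.
  Iterating over time and applying Fubini, the multi-scan integral becomes a sum over label
  sequences \<open>I\<close> of integrals over states indexed by the pairs \<open>(i, l)\<close> with \<open>l \<in> I i\<close>.
  When every label lives on an interval of times, these pairs split into trajectories, so each
  term of the GLMB series integrates to its weight, as a product of probability densities.  By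
  monotone convergence the \<open>L\<^sub>1\<close>-norm of a subseries is its total weight.  For the second
  inequality write, with \<open>a\<close> and \<open>b\<close> the norms of \<open>f H\<close> and \<open>f T\<close>,
  \<open>f H / a - f T / b = (f H - f T) / a - f T * (1 / b - 1 / a)\<close>.
\<close>

subsection \<open>Products of a single measure\<close>

text \<open>The push-forward of the product over \<open>I\<close> under the renaming of coordinates
  agrees with the product over \<open>J\<close> on boxes, and by sigma-finiteness boxes determine
  it.\<close>

lemma nn_integral_PiM_reindex:
  fixes M :: "'a measure" and h :: "'j \<Rightarrow> 'i" and F :: "('j \<Rightarrow> 'a) \<Rightarrow> ennreal"
  assumes M: "sigma_finite_measure M" and fin: "finite J" and h: "bij_betw h J I"
    and F: "F \<in> borel_measurable (\<Pi>\<^sub>M j\<in>J. M)"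
  shows "(\<integral>\<^sup>+x. F x \<partial>(\<Pi>\<^sub>M j\<in>J. M)) = (\<integral>\<^sup>+x. F (\<lambda>j\<in>J. x (h j)) \<partial>(\<Pi>\<^sub>M i\<in>I. M))"
proof -
  interpret I: product_sigma_finite "\<lambda>_::'i. M"
    using M by (simp add: product_sigma_finite_def)
  interpret J: product_sigma_finite "\<lambda>_::'j. M"
    using M by (simp add: product_sigma_finite_def)
  let ?r = "\<lambda>x. \<lambda>j\<in>J. x (h j)"
  have finI: "finite I"
    using h fin bij_betw_finite by blast
  have hI: "h j \<in> I" if "j \<in> J" for j
    using h that by (auto simp: bij_betw_def)
  have inv: "the_inv_into J h (h j) = j" if "j \<in> J" for j
    using h that by (auto simp: bij_betw_def the_inv_into_f_f)
  have r: "?r \<in> measurable (\<Pi>\<^sub>M i\<in>I. M) (\<Pi>\<^sub>M j\<in>J. M)"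
    by (rule measurable_restrict) (simp add: hI)
  have "distr (\<Pi>\<^sub>M i\<in>I. M) (\<Pi>\<^sub>M j\<in>J. M) ?r = (\<Pi>\<^sub>M j\<in>J. M)"
  proof (rule J.PiM_eqI[OF fin])
    fix A assume A: "\<And>j. j \<in> J \<Longrightarrow> A j \<in> sets M"
    have sub: "A j \<subseteq> space M" if "j \<in> J" for j
      using A[OF that] by (rule sets.sets_into_space)
    let ?A = "\<lambda>i. A (the_inv_into J h i)"
    have vim: "?r -` Pi\<^sub>E J A \<inter> space (\<Pi>\<^sub>M i\<in>I. M) = Pi\<^sub>E I ?A"
    proof (intro equalityI subsetI)
      fix x assume "x \<in> ?r -` Pi\<^sub>E J A \<inter> space (\<Pi>\<^sub>M i\<in>I. M)"
      then have x: "\<And>j. j \<in> J \<Longrightarrow> x (h j) \<in> A j" "x \<in> extensional I"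
        by (auto simp: space_PiM PiE_iff)
      have "x i \<in> ?A i" if "i \<in> I" for i
      proof -
        obtain j where "j \<in> J" "i = h j"
          using h \<open>i \<in> I\<close> unfolding bij_betw_def by blast
        then show ?thesis using x inv by auto
      qed
      with x show "x \<in> Pi\<^sub>E I ?A" by (auto simp: PiE_iff)
    next
      fix x assume x: "x \<in> Pi\<^sub>E I ?A"
      have "x i \<in> space M" if "i \<in> I" for i
      proof -
        obtain j where "j \<in> J" "i = h j"
          using h \<open>i \<in> I\<close> unfolding bij_betw_def by blast
        then have "x i \<in> A j" using x inv that by (auto simp: PiE_iff)
        then show ?thesis using sub[OF \<open>j \<in> J\<close>] by blast
      qed
      moreover have "x (h j) \<in> A j" if "j \<in> J" for j
        using x hI[OF that] inv[OF that] by (auto simp: PiE_iff)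
      ultimately show "x \<in> ?r -` Pi\<^sub>E J A \<inter> space (\<Pi>\<^sub>M i\<in>I. M)"
        using x by (auto simp: space_PiM PiE_iff)
    qed
    have "emeasure (distr (\<Pi>\<^sub>M i\<in>I. M) (\<Pi>\<^sub>M j\<in>J. M) ?r) (Pi\<^sub>E J A) =
        emeasure (\<Pi>\<^sub>M i\<in>I. M) (Pi\<^sub>E I ?A)"
      using A fin by (subst emeasure_distr[OF r]) (auto simp: vim)
    also have "\<dots> = (\<Prod>i\<in>I. emeasure M (?A i))"
    proof (rule I.emeasure_PiM[OF finI])
      fix i assume "i \<in> I"
      then obtain j where "j \<in> J" "i = h j"
        using h by (auto simp: bij_betw_def)
      then show "?A i \<in> sets M" using A inv by simp
    qed
    also have "\<dots> = (\<Prod>j\<in>J. emeasure M (A j))"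
      using inv by (subst prod.reindex_bij_betw[OF h, symmetric]) simp
    finally show "emeasure (distr (\<Pi>\<^sub>M i\<in>I. M) (\<Pi>\<^sub>M j\<in>J. M) ?r) (Pi\<^sub>E J A) =
        (\<Prod>j\<in>J. emeasure M (A j))" .
  qed simp
  then show ?thesis
    using nn_integral_distr[OF r, of F] F by simp
qed

text \<open>By Fubini, integrate the indicator of the diagonal first over the coordinate
  \<open>a\<close>, then over \<open>b\<close>: this already gives 0, so the remaining coordinates
  integrate 0 even if their measure is infinite.\<close>

lemma diffuse_AE_PiM_neq:
  fixes M :: "'a measure" and I :: "'i set"
  assumes M: "sigma_finite_measure M" and "diffuse M"
    and "finite I" "a \<in> I" "b \<in> I" "a \<noteq> b"
  shows "AE x in (\<Pi>\<^sub>M i\<in>I. M). x a \<noteq> x b"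
proof -
  interpret sigma_finite_measure M by fact
  interpret pair_sigma_finite M M ..
  interpret product_sigma_finite "\<lambda>_::'i. M"
    using M by (simp add: product_sigma_finite_def)
  let ?D = "{z \<in> space (M \<Otimes>\<^sub>M M). fst z = snd z}"
  have D [measurable]: "?D \<in> sets (M \<Otimes>\<^sub>M M)" and D0: "emeasure (M \<Otimes>\<^sub>M M) ?D = 0"
    using \<open>diffuse M\<close> by (auto simp: diffuse_def null_sets_def)
  \<comment> \<open>\<open>?g z\<close> is the measure of the slice of the diagonal at
    \<open>z\<close>; its integral is the measure of the diagonal, which is 0.\<close>
  let ?g = "\<lambda>z. \<integral>\<^sup>+y. indicator ?D (y, z) \<partial>M"
  have g [measurable]: "?g \<in> borel_measurable M" by measurable
  have "(\<integral>\<^sup>+z. ?g z \<partial>M) = emeasure (M \<Otimes>\<^sub>M M) ?D"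
    by (subst nn_integral_snd) (simp_all add: case_prod_eta)
  then have g0: "(\<integral>\<^sup>+z. ?g z \<partial>M) = 0" using D0 by simp
  define R where "R = I - {a, b}"
  have R: "finite R" "b \<notin> R" "finite (insert b R)" "a \<notin> insert b R" "I = insert a (insert b R)"
    using assms by (auto simp: R_def)
  have a [measurable]: "(\<lambda>x. x a) \<in> measurable (\<Pi>\<^sub>M i\<in>I. M) M"
    and b [measurable]: "(\<lambda>x. x b) \<in> measurable (\<Pi>\<^sub>M i\<in>I. M) M"
    using assms by auto
  have f: "(\<lambda>x. indicator ?D (x a, x b) :: ennreal) \<in> borel_measurable (\<Pi>\<^sub>M i\<in>I. M)"
    by measurable
  have gb: "(\<lambda>x. ?g (x b)) \<in> borel_measurable (\<Pi>\<^sub>M i\<in>insert b R. M)"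
    by (rule measurable_compose[OF _ g]) simp
  have "(\<integral>\<^sup>+x. indicator ?D (x a, x b) \<partial>(\<Pi>\<^sub>M i\<in>I. M)) =
      (\<integral>\<^sup>+x. ?g (x b) \<partial>(\<Pi>\<^sub>M i\<in>insert b R. M))"
    using product_nn_integral_insert[OF R(3,4), of "\<lambda>x. indicator ?D (x a, x b)"] f R(4)
    by (simp add: R(5)[symmetric] \<open>a \<noteq> b\<close>[symmetric])
  also have "\<dots> = (\<integral>\<^sup>+x. (\<integral>\<^sup>+z. ?g z \<partial>M) \<partial>(\<Pi>\<^sub>M i\<in>R. M))"
    using product_nn_integral_insert[OF R(1,2) gb] by simp
  also have "\<dots> = 0" using g0 by simp
  finally have "AE x in (\<Pi>\<^sub>M i\<in>I. M). indicator ?D (x a, x b) = (0::ennreal)"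
    using f by (subst (asm) nn_integral_0_iff_AE) auto
  then show ?thesis
    apply (rule AE_mp)
    apply (rule AE_I2) using assms by (auto simp: indicator_def space_PiM space_pair_measure PiE_iff split: if_splits)
qed

text \<open>Such tuples correspond to the duplicate-free lists that enumerate \<open>J\<close>, that
  is, to its permutations.\<close>

lemma card_PiE_bijections:
  assumes "finite J"
  shows "card {l \<in> {..<card J} \<rightarrow>\<^sub>E J. inj_on l {..<card J} \<and> l ` {..<card J} = J} = fact (card J)"
proof -
  let ?n = "card J"
  let ?S = "{l \<in> {..<?n} \<rightarrow>\<^sub>E J. inj_on l {..<?n} \<and> l ` {..<?n} = J}"
  have "bij_betw (\<lambda>l. map l [0..<?n]) ?S (permutations_of_set J)"
  proof (rule bij_betw_byWitness[where f' = "\<lambda>xs. \<lambda>i\<in>{..<?n}. xs ! i"])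
    show "\<forall>l\<in>?S. (\<lambda>i\<in>{..<?n}. map l [0..<?n] ! i) = l"
      by (auto simp: fun_eq_iff PiE_iff extensional_def)
    show "\<forall>xs\<in>permutations_of_set J. map (\<lambda>i\<in>{..<?n}. xs ! i) [0..<?n] = xs"
      by (auto simp: permutations_of_set_def distinct_card intro!: nth_equalityI)
    show "(\<lambda>l. map l [0..<?n]) ` ?S \<subseteq> permutations_of_set J"
      by (auto simp: permutations_of_set_def distinct_map lessThan_atLeast0)
    show "(\<lambda>xs. \<lambda>i\<in>{..<?n}. xs ! i) ` permutations_of_set J \<subseteq> ?S"
    proof (intro subsetI, elim imageE)
      fix l xs assume xs: "xs \<in> permutations_of_set J" and l: "l = (\<lambda>i\<in>{..<?n}. xs ! i)"
      then have "set xs = J" "distinct xs" and n: "length xs = ?n"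
        by (auto simp: permutations_of_set_def distinct_card)
      then have "bij_betw ((!) xs) {..<?n} J"
        by (intro bij_betw_nth) auto
      then have "bij_betw l {..<?n} J"
        unfolding l by (rule bij_betw_cong[THEN iffD1, rotated]) simp
      then show "l \<in> ?S"
        unfolding bij_betw_def by (auto simp: PiE_iff l)
    qed
  qed
  then show ?thesis
    using assms bij_betw_same_card by fastforce
qed

text \<open>Distinct states prevent two entries of the tuple from collapsing, so the set has
  \<open>card A\<close> elements; a non-zero distinct label indicator then demands as many
  labels.\<close>

lemma inj_on_of_distinct_labels:
  assumes "distinct_labels ((\<lambda>a. (x a, l a)) ` A) \<noteq> 0" and "finite A"
    and "\<And>a b. a \<in> A \<Longrightarrow> b \<in> A \<Longrightarrow> a \<noteq> b \<Longrightarrow> x a \<noteq> x b"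
  shows "inj_on l A"
proof -
  have "inj_on (\<lambda>a. (x a, l a)) A"
    by (rule inj_onI) (metis assms(3) prod.inject)
  then have "card ((\<lambda>a. (x a, l a)) ` A) = card A"
    by (rule card_image)
  moreover have "labels ((\<lambda>a. (x a, l a)) ` A) = l ` A"
    by (simp add: labels_def image_image)
  ultimately have "card (l ` A) = card A"
    using assms(1) by (simp add: distinct_labels_def)
  then show ?thesis
    using \<open>finite A\<close> eq_card_imp_inj_on by blast
qed

subsection \<open>Set integrals of functions supported on distinct labels\<close>

text \<open>Tuples with a repeated label integrate to 0, and an injective tuple contributes
  according to its label set alone, so the \<open>fact n\<close> listings of each \<open>J\<close>
  cancel the factor 1/n!. The states are indexed by \<open>{i} \<times> J\<close> and not by
  \<open>J\<close> so that different times can later be merged in one product.\<close>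

lemma set_nn_integral_eq_sum_Pow:
  fixes M :: "'a measure" and L :: "'b label set" and i :: 't
  assumes M: "sigma_finite_measure M" "diffuse M" and L: "finite L"
    and zero: "\<And>Y. distinct_labels Y = 0 \<Longrightarrow> G Y = 0"
    and meas: "\<And>J. J \<subseteq> L \<Longrightarrow>
      (\<lambda>x. G ((\<lambda>l. (x (i, l), l)) ` J)) \<in> borel_measurable (\<Pi>\<^sub>M _\<in>{i} \<times> J. M)"
  shows "set_nn_integral M L G =
    (\<Sum>J\<in>Pow L. \<integral>\<^sup>+x. G ((\<lambda>l. (x (i, l), l)) ` J) \<partial>(\<Pi>\<^sub>M _\<in>{i} \<times> J. M))"
proof -
  define \<psi> where "\<psi> J = (\<integral>\<^sup>+x. G ((\<lambda>l. (x (i, l), l)) ` J) \<partial>(\<Pi>\<^sub>M _\<in>{i} \<times> J. M))" for J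
  let ?int = "\<lambda>n l. \<integral>\<^sup>+x. G ((\<lambda>a. (x a, l a)) ` {..<n}) \<partial>(\<Pi>\<^sub>M a\<in>{..<n}. M)"
  \<comment> \<open>Almost every tuple has pairwise distinct states, since the measure is diffuse; a
    repeated label then leaves fewer labels than elements, and \<open>G\<close> vanishes.\<close>
  have not_inj: "?int n l = 0" if "\<not> inj_on l {..<n}" for n :: nat and l :: "nat \<Rightarrow> 'b label"
  proof -
    have "AE x in (\<Pi>\<^sub>M a\<in>{..<n}. M). \<forall>a\<in>{..<n}. \<forall>b\<in>{..<n} - {a}. x a \<noteq> x b"
      using M by (intro AE_finite_allI diffuse_AE_PiM_neq) auto
    then have "AE x in (\<Pi>\<^sub>M a\<in>{..<n}. M). G ((\<lambda>a. (x a, l a)) ` {..<n}) = 0"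
    proof eventually_elim
      case (elim x)
      then have "distinct_labels ((\<lambda>a. (x a, l a)) ` {..<n}) = 0"
        using inj_on_of_distinct_labels[of x l "{..<n}"] that by auto
      then show ?case by (rule zero)
    qed
    then have "?int n l = (\<integral>\<^sup>+x. 0 \<partial>(\<Pi>\<^sub>M a\<in>{..<n}. M))"
      by (rule nn_integral_cong_AE)
    then show ?thesis by simp
  qed
  have inj: "?int n l = \<psi> (l ` {..<n})"
    if l: "l \<in> {..<n} \<rightarrow>\<^sub>E L" "inj_on l {..<n}" for n :: nat and l :: "nat \<Rightarrow> 'b label"
  proof -
    \<comment> \<open>\<open>?h\<close> sends \<open>(i, b)\<close> to the position of the label
      \<open>b\<close> in the tuple \<open>l\<close>.\<close>
    let ?J = "l ` {..<n}" and ?h = "\<lambda>(_, b). the_inv_into {..<n} l b"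
    have J: "?J \<subseteq> L" using PiE_mem[OF l(1)] by blast
    have "bij_betw (the_inv_into {..<n} l) ?J {..<n}"
      using l(2) by (simp add: bij_betw_the_inv_into bij_betw_imageI)
    moreover have "bij_betw snd ({i} \<times> ?J) ?J"
      by (auto simp: bij_betw_def inj_on_def)
    ultimately have "bij_betw (the_inv_into {..<n} l \<circ> snd) ({i} \<times> ?J) {..<n}"
      by (rule bij_betw_trans[rotated])
    moreover have "the_inv_into {..<n} l \<circ> snd = (?h :: 't \<times> _ \<Rightarrow> _)"
      by (simp add: fun_eq_iff split_beta)
    ultimately have h: "bij_betw ?h ({i} \<times> ?J) {..<n}" by simp
    have "\<psi> ?J = (\<integral>\<^sup>+x. G ((\<lambda>b. ((\<lambda>j\<in>{i} \<times> ?J. x (?h j)) (i, b), b)) ` ?J) \<partial>(\<Pi>\<^sub>M a\<in>{..<n}. M))"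
      unfolding \<psi>_def by (rule nn_integral_PiM_reindex[OF M(1) _ h meas[OF J]]) simp
    also have "\<dots> = ?int n l"
    proof (rule nn_integral_cong)
      fix x :: "nat \<Rightarrow> 'a"
      have "(\<lambda>b. ((\<lambda>j\<in>{i} \<times> ?J. x (?h j)) (i, b), b)) ` ?J = (\<lambda>a. (x a, l a)) ` {..<n}"
        using l(2) by (auto simp: image_image the_inv_into_f_f intro!: image_cong)
      then show "G ((\<lambda>b. ((\<lambda>j\<in>{i} \<times> ?J. x (?h j)) (i, b), b)) ` ?J) = G ((\<lambda>a. (x a, l a)) ` {..<n})"
        by simp
    qed
    finally show ?thesis ..
  qed
  have n_term: "(\<Sum>l\<in>{..<n} \<rightarrow>\<^sub>E L. ?int n l) / fact n = (\<Sum>J | J \<subseteq> L \<and> card J = n. \<psi> J)" for n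
  proof -
    let ?P = "{..<n} \<rightarrow>\<^sub>E L" and ?\<J> = "{J. J \<subseteq> L \<and> card J = n}"
    let ?S = "{l \<in> ?P. inj_on l {..<n}}"
    have fin: "finite ?P" "finite ?\<J>"
      using L by (auto intro: finite_PiE)
    have "(\<Sum>l\<in>?P. ?int n l) = (\<Sum>l\<in>?S. \<psi> (l ` {..<n}))"
      using fin not_inj inj by (intro sum.mono_neutral_cong_right) auto
    \<comment> \<open>Group the injective tuples by their label set; each group has
      \<open>fact n\<close> members with the common value \<open>\<psi> J\<close>.\<close>
    also have "\<dots> = (\<Sum>J\<in>?\<J>. \<Sum>l | l \<in> ?S \<and> l ` {..<n} = J. \<psi> (l ` {..<n}))"
    proof (rule sum.group[symmetric])
      show "finite ?S" using fin by simp
      show "(\<lambda>l. l ` {..<n}) ` ?S \<subseteq> ?\<J>"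
        by (rule image_subsetI) (simp add: card_image PiE_iff image_subset_iff)
    qed (use fin in simp)
    also have "\<dots> = (\<Sum>J\<in>?\<J>. fact n * \<psi> J)"
    proof (rule sum.cong[OF refl])
      fix J assume J: "J \<in> ?\<J>"
      then have "finite J" using L finite_subset by auto
      have "{l \<in> ?S. l ` {..<n} = J} = {l \<in> {..<card J} \<rightarrow>\<^sub>E J. inj_on l {..<card J} \<and> l ` {..<card J} = J}"
        using J by (intro Collect_cong) (simp add: PiE_iff, blast)
      then have "card {l \<in> ?S. l ` {..<n} = J} = fact n"
        using card_PiE_bijections[OF \<open>finite J\<close>] J by simp
      moreover have "(\<Sum>l | l \<in> ?S \<and> l ` {..<n} = J. \<psi> (l ` {..<n})) = of_nat (card {l \<in> ?S. l ` {..<n} = J}) * \<psi> J"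
        by (subst sum.cong[OF refl, where h = "\<lambda>_. \<psi> J"]) auto
      ultimately show "(\<Sum>l | l \<in> ?S \<and> l ` {..<n} = J. \<psi> (l ` {..<n})) = fact n * \<psi> J"
        by simp
    qed
    also have "\<dots> = (\<Sum>J\<in>?\<J>. \<psi> J) * fact n"
      by (simp add: sum_distrib_left mult.commute)
    finally show ?thesis
      by (simp add: ennreal_mult_divide_eq)
  qed
  have "set_nn_integral M L G = (\<Sum>n. \<Sum>J | J \<subseteq> L \<and> card J = n. \<psi> J)"
    unfolding set_nn_integral_def n_term ..
  also have "\<dots> = (\<Sum>n\<in>{..card L}. \<Sum>J | J \<subseteq> L \<and> card J = n. \<psi> J)"
  proof (rule suminf_finite)
    fix n assume n: "n \<notin> {..card L}"
    have "{J. J \<subseteq> L \<and> card J = n} = {}"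
      using n card_mono[OF L] by auto
    then show "(\<Sum>J | J \<subseteq> L \<and> card J = n. \<psi> J) = 0" by (simp only: sum.empty)
  qed simp
  also have "\<dots> = (\<Sum>J\<in>Pow L. \<psi> J)"
    using L card_mono[OF L] sum.group[of "Pow L" "{..card L}" card \<psi>] by auto
  finally show ?thesis
    unfolding \<psi>_def .
qed

section \<open>Iterated set integrals as sums over label sequences\<close>

text \<open>Assembles a sequence of labelled sets from states indexed by time-label pairs. Outside
  \<open>A\<close> it is \<open>undefined\<close>, like the sequence at which
  \<open>iter_set_nn_integral\<close> evaluates its integrand in the base case.\<close>

definition state_sets :: "nat set \<Rightarrow> (nat \<Rightarrow> 'b label set) \<Rightarrow> (nat \<times> 'b label \<Rightarrow> 'a) \<Rightarrow>
    nat \<Rightarrow> ('a \<times> 'b label) set" where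
  "state_sets A I x = (\<lambda>i\<in>A. (\<lambda>l. (x (i, l), l)) ` I i)"

text \<open>Fixing the set at a new time amounts to merging its states with those of the other
  times; \<open>merge\<close> is the form in which Fubini joins two products of measures.\<close>

lemma state_sets_upd:
  assumes "i \<notin> A"
  shows "(state_sets A I y)(i := (\<lambda>l. (x (i, l), l)) ` J) =
    state_sets (insert i A) (I(i := J)) (merge ({i} \<times> J) (Sigma A I) (x, y))"
proof (rule ext)
  fix a
  show "((state_sets A I y)(i := (\<lambda>l. (x (i, l), l)) ` J)) a =
    state_sets (insert i A) (I(i := J)) (merge ({i} \<times> J) (Sigma A I) (x, y)) a"
    using assms by (auto simp: state_sets_def merge_def intro!: image_cong)
qed

lemma Sigma_insert_upd:
  assumes "i \<notin> A"
  shows "Sigma (insert i A) (I(i := J)) = {i} \<times> J \<union> Sigma A I"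
  using assms by (auto split: if_splits)

lemma set_nn_integral_0: "set_nn_integral M L (\<lambda>_. 0) = 0"
  by (simp add: set_nn_integral_def)

lemma iter_set_nn_integral_0: "iter_set_nn_integral M L is (\<lambda>_. 0) = 0"
  by (induction "is") (simp_all add: set_nn_integral_0)

text \<open>Induction over the times: the outer set integral is a sum over label sets
  \<open>J\<close> at time \<open>i\<close>, the induction hypothesis applies to \<open>F\<close>
  with the set at time \<open>i\<close> fixed, and Fubini merges the two integrals.\<close>

lemma iter_set_nn_integral_eq_sum:
  fixes M :: "'a measure" and L :: "nat \<Rightarrow> 'b label set"
  assumes M: "sigma_finite_measure M" "diffuse M"
    and "distinct is" and "\<And>i. i \<in> set is \<Longrightarrow> finite (L i)"
    and "\<And>X i. i \<in> set is \<Longrightarrow> distinct_labels (X i) = 0 \<Longrightarrow> F X = 0"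
    and "\<And>I. I \<in> (\<Pi>\<^sub>E i\<in>set is. Pow (L i)) \<Longrightarrow>
      (\<lambda>x. F (state_sets (set is) I x)) \<in> borel_measurable (\<Pi>\<^sub>M _\<in>Sigma (set is) I. M)"
  shows "iter_set_nn_integral M L is F =
    (\<Sum>I\<in>(\<Pi>\<^sub>E i\<in>set is. Pow (L i)).
      \<integral>\<^sup>+x. F (state_sets (set is) I x) \<partial>(\<Pi>\<^sub>M _\<in>Sigma (set is) I. M))"
  using assms(3-)
proof (induction "is" arbitrary: F)
  case Nil
  \<comment> \<open>There is one label sequence and no coordinate: the empty product measure is a
    unit point mass.\<close>
  show ?case
    by (simp add: PiM_empty state_sets_def nn_integral_count_space_finite restrict_def)
next
  case (Cons i "is")
  interpret product_sigma_finite "\<lambda>_ :: nat \<times> 'b label. M"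
    using M by (simp add: product_sigma_finite_def)
  let ?A = "set is"
  let ?Y = "\<lambda>J x. (\<lambda>l. (x (i, l), l)) ` J"
  let ?H = "\<lambda>I z. F (state_sets (insert i ?A) I z)"
  have iA: "i \<notin> ?A" and dist: "distinct is"
    using Cons.prems(1) by auto
  have L: "finite (L i)" "\<And>a. a \<in> ?A \<Longrightarrow> finite (L a)"
    using Cons.prems(2) by auto
  have fin: "finite (Sigma ?A I)" if "I \<in> (\<Pi>\<^sub>E i\<in>?A. Pow (L i))" for I
    using that L(2) by (intro finite_SigmaI) (auto simp: PiE_iff intro: finite_subset)
  have finJ: "finite ({i} \<times> J)" if "J \<subseteq> L i" for J
    using that L(1) by (auto intro: finite_subset)
  have H: "(\<lambda>z. ?H (I(i := J)) z) \<in> borel_measurable (\<Pi>\<^sub>M _\<in>{i} \<times> J \<union> Sigma ?A I. M)"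
    if "I \<in> (\<Pi>\<^sub>E i\<in>?A. Pow (L i))" "J \<subseteq> L i" for I J
  proof -
    have "I(i := J) \<in> (\<Pi>\<^sub>E i\<in>set (i # is). Pow (L i))"
      using that by (auto simp: PiE_iff extensional_def)
    from Cons.prems(4)[OF this] show ?thesis
      unfolding list.set Sigma_insert_upd[OF iA] .
  qed
  \<comment> \<open>Joint measurability in the states at time \<open>i\<close> and those at the
    remaining times serves twice: its sections satisfy the induction hypothesis, and its partial
    integrals are measurable in the states at time \<open>i\<close>.\<close>
  have Hm: "(\<lambda>(x, y). ?H (I(i := J)) (merge ({i} \<times> J) (Sigma ?A I) (x, y))) \<in>
      borel_measurable ((\<Pi>\<^sub>M _\<in>{i} \<times> J. M) \<Otimes>\<^sub>M (\<Pi>\<^sub>M _\<in>Sigma ?A I. M))"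
    if "I \<in> (\<Pi>\<^sub>E i\<in>?A. Pow (L i))" "J \<subseteq> L i" for I J
    using measurable_compose[OF measurable_merge H[OF that]] by (simp add: split_def)
  have inner: "iter_set_nn_integral M L is (\<lambda>X. F (X(i := ?Y J x))) =
      (\<Sum>I\<in>(\<Pi>\<^sub>E i\<in>?A. Pow (L i)).
        \<integral>\<^sup>+y. ?H (I(i := J)) (merge ({i} \<times> J) (Sigma ?A I) (x, y)) \<partial>(\<Pi>\<^sub>M _\<in>Sigma ?A I. M))"
    if J: "J \<subseteq> L i" and x: "x \<in> space (\<Pi>\<^sub>M _\<in>{i} \<times> J. M)" for J x
  proof -
    have "iter_set_nn_integral M L is (\<lambda>X. F (X(i := ?Y J x))) =
        (\<Sum>I\<in>(\<Pi>\<^sub>E i\<in>?A. Pow (L i)).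
          \<integral>\<^sup>+y. F ((state_sets ?A I y)(i := ?Y J x)) \<partial>(\<Pi>\<^sub>M _\<in>Sigma ?A I. M))"
    proof (rule Cons.IH[OF dist L(2)])
      fix X :: "nat \<Rightarrow> ('a \<times> 'b label) set" and a
      assume "a \<in> ?A" "distinct_labels (X a) = 0"
      then show "F (X(i := ?Y J x)) = 0"
        using iA by (intro Cons.prems(3)[of a]) auto
    next
      fix I assume I: "I \<in> (\<Pi>\<^sub>E i\<in>?A. Pow (L i))"
      show "(\<lambda>y. F ((state_sets ?A I y)(i := ?Y J x))) \<in> borel_measurable (\<Pi>\<^sub>M _\<in>Sigma ?A I. M)"
        unfolding state_sets_upd[OF iA]
        using measurable_compose[OF measurable_Pair1'[OF x] Hm[OF I J]] by simp
    qed
    then show ?thesis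
      unfolding state_sets_upd[OF iA] .
  qed
  have meas_inner: "(\<lambda>x. \<integral>\<^sup>+y. ?H (I(i := J)) (merge ({i} \<times> J) (Sigma ?A I) (x, y)) \<partial>(\<Pi>\<^sub>M _\<in>Sigma ?A I. M))
      \<in> borel_measurable (\<Pi>\<^sub>M _\<in>{i} \<times> J. M)"
    if "I \<in> (\<Pi>\<^sub>E i\<in>?A. Pow (L i))" "J \<subseteq> L i" for I J
    using sigma_finite_measure.borel_measurable_nn_integral[OF sigma_finite[OF fin[OF that(1)]] Hm[OF that]] .
  have "iter_set_nn_integral M L (i # is) F =
      (\<Sum>J\<in>Pow (L i). \<integral>\<^sup>+x. iter_set_nn_integral M L is (\<lambda>X. F (X(i := ?Y J x))) \<partial>(\<Pi>\<^sub>M _\<in>{i} \<times> J. M))"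
    unfolding iter_set_nn_integral.simps
  proof (rule set_nn_integral_eq_sum_Pow[OF M L(1)])
    fix Y :: "('a \<times> 'b label) set" assume "distinct_labels Y = 0"
    \<comment> \<open>\<open>F\<close> vanishes whatever the other sets are, so the inner iterated
      integral is that of the zero function.\<close>
    then have "F (X(i := Y)) = 0" for X
      by (intro Cons.prems(3)[of i]) auto
    then show "iter_set_nn_integral M L is (\<lambda>X. F (X(i := Y))) = 0"
      by (simp add: iter_set_nn_integral_0)
  next
    fix J assume J: "J \<subseteq> L i"
    show "(\<lambda>x. iter_set_nn_integral M L is (\<lambda>X. F (X(i := ?Y J x)))) \<in> borel_measurable (\<Pi>\<^sub>M _\<in>{i} \<times> J. M)"
      by (subst measurable_cong[OF inner[OF J]]) (auto intro!: borel_measurable_sum meas_inner J)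
  qed
  also have "\<dots> = (\<Sum>J\<in>Pow (L i). \<Sum>I\<in>(\<Pi>\<^sub>E i\<in>?A. Pow (L i)).
      \<integral>\<^sup>+z. ?H (I(i := J)) z \<partial>(\<Pi>\<^sub>M _\<in>Sigma (insert i ?A) (I(i := J)). M))"
  proof (rule sum.cong[OF refl])
    fix J assume "J \<in> Pow (L i)"
    then have J: "J \<subseteq> L i" by simp
    have "(\<integral>\<^sup>+x. iter_set_nn_integral M L is (\<lambda>X. F (X(i := ?Y J x))) \<partial>(\<Pi>\<^sub>M _\<in>{i} \<times> J. M)) =
      (\<integral>\<^sup>+x. (\<Sum>I\<in>(\<Pi>\<^sub>E i\<in>?A. Pow (L i)). \<integral>\<^sup>+y. ?H (I(i := J)) (merge ({i} \<times> J) (Sigma ?A I) (x, y)) \<partial>(\<Pi>\<^sub>M _\<in>Sigma ?A I. M))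
        \<partial>(\<Pi>\<^sub>M _\<in>{i} \<times> J. M))"
      using inner[OF J] by (rule nn_integral_cong)
    also have "\<dots> = (\<Sum>I\<in>(\<Pi>\<^sub>E i\<in>?A. Pow (L i)). \<integral>\<^sup>+x. \<integral>\<^sup>+y. ?H (I(i := J)) (merge ({i} \<times> J) (Sigma ?A I) (x, y))
        \<partial>(\<Pi>\<^sub>M _\<in>Sigma ?A I. M) \<partial>(\<Pi>\<^sub>M _\<in>{i} \<times> J. M))"
      using meas_inner J by (intro nn_integral_sum) simp
    also have "\<dots> = (\<Sum>I\<in>(\<Pi>\<^sub>E i\<in>?A. Pow (L i)).
      \<integral>\<^sup>+z. ?H (I(i := J)) z \<partial>(\<Pi>\<^sub>M _\<in>Sigma (insert i ?A) (I(i := J)). M))"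
    proof (rule sum.cong[OF refl])
      fix I assume I: "I \<in> (\<Pi>\<^sub>E i\<in>?A. Pow (L i))"
      have disj: "({i} \<times> J) \<inter> Sigma ?A I = {}"
        using iA by auto
      show "(\<integral>\<^sup>+x. \<integral>\<^sup>+y. ?H (I(i := J)) (merge ({i} \<times> J) (Sigma ?A I) (x, y))
          \<partial>(\<Pi>\<^sub>M _\<in>Sigma ?A I. M) \<partial>(\<Pi>\<^sub>M _\<in>{i} \<times> J. M)) =
        (\<integral>\<^sup>+z. ?H (I(i := J)) z \<partial>(\<Pi>\<^sub>M _\<in>Sigma (insert i ?A) (I(i := J)). M))"
        unfolding Sigma_insert_upd[OF iA]
        by (rule product_nn_integral_fold[OF disj finJ[OF J] fin[OF I] H[OF I J], symmetric])
    qed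
    finally show "(\<integral>\<^sup>+x. iter_set_nn_integral M L is (\<lambda>X. F (X(i := ?Y J x))) \<partial>(\<Pi>\<^sub>M _\<in>{i} \<times> J. M)) = \<dots>" .
  qed
  also have "\<dots> = (\<Sum>(J, I)\<in>Pow (L i) \<times> (\<Pi>\<^sub>E i\<in>?A. Pow (L i)).
      \<integral>\<^sup>+z. ?H (I(i := J)) z \<partial>(\<Pi>\<^sub>M _\<in>Sigma (insert i ?A) (I(i := J)). M))"
    by (rule sum.cartesian_product)
  \<comment> \<open>A label sequence over \<open>insert i ?A\<close> is uniquely a set
    \<open>J\<close> at \<open>i\<close> together with a sequence over \<open>?A\<close>.\<close>
  also have "\<dots> = (\<Sum>I\<in>(\<Pi>\<^sub>E i\<in>insert i ?A. Pow (L i)).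
      \<integral>\<^sup>+z. ?H I z \<partial>(\<Pi>\<^sub>M _\<in>Sigma (insert i ?A) I. M))"
    unfolding PiE_insert_eq using iA
    by (subst sum.reindex[OF inj_combinator]) (auto simp: split_def)
  finally show ?case by simp
qed

text \<open>Fubini peels off one label at a time: the coordinates with second component
  \<open>l\<close> form a block, and \<open>g l\<close> is the only factor that depends on
  it.\<close>

lemma nn_integral_PiM_prod_slices:
  fixes M :: "'a measure" and A :: "'l \<Rightarrow> 't set" and g :: "'l \<Rightarrow> ('t \<Rightarrow> 'a) \<Rightarrow> ennreal"
  assumes M: "sigma_finite_measure M" and "finite \<Lambda>" and "\<And>l. l \<in> \<Lambda> \<Longrightarrow> finite (A l)"
    and "\<And>l. l \<in> \<Lambda> \<Longrightarrow> g l \<in> borel_measurable (\<Pi>\<^sub>M i\<in>A l. M)"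
  shows "(\<integral>\<^sup>+x. (\<Prod>l\<in>\<Lambda>. g l (\<lambda>i\<in>A l. x (i, l))) \<partial>(\<Pi>\<^sub>M _\<in>{(i, l). l \<in> \<Lambda> \<and> i \<in> A l}. M)) =
    (\<Prod>l\<in>\<Lambda>. \<integral>\<^sup>+y. g l y \<partial>(\<Pi>\<^sub>M i\<in>A l. M))"
  using assms(2-)
proof (induction \<Lambda>)
  case empty
  then show ?case
    by (simp add: PiM_empty nn_integral_count_space_finite)
next
  case (insert l \<Lambda>)
  interpret product_sigma_finite "\<lambda>_ :: 't \<times> 'l. M"
    using M by (simp add: product_sigma_finite_def)
  let ?K = "\<lambda>\<Lambda>. {(i, l). l \<in> \<Lambda> \<and> i \<in> A l}"
  let ?p = "\<lambda>\<Lambda> x. \<Prod>l\<in>\<Lambda>. g l (\<lambda>i\<in>A l. x (i, l))"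
  have K: "?K (insert l \<Lambda>) = A l \<times> {l} \<union> ?K \<Lambda>" and disj: "(A l \<times> {l}) \<inter> ?K \<Lambda> = {}"
    using insert.hyps by auto
  have "?K \<Lambda> = (\<Union>l\<in>\<Lambda>. A l \<times> {l})" by auto
  then have fin: "finite (A l \<times> {l})" "finite (?K \<Lambda>)"
    using insert by auto
  have meas: "(\<lambda>x. g l' (\<lambda>i\<in>A l'. x (i, l'))) \<in> borel_measurable (\<Pi>\<^sub>M _\<in>I. M)"
    if "l' \<in> insert l \<Lambda>" "A l' \<times> {l'} \<subseteq> I" for l' I
  proof -
    have "(\<lambda>x. \<lambda>i\<in>A l'. x (i, l')) \<in> measurable (\<Pi>\<^sub>M _\<in>I. M) (\<Pi>\<^sub>M i\<in>A l'. M)"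
      using that(2) by (intro measurable_restrict measurable_component_singleton) auto
    from measurable_compose[OF this insert.prems(2)[OF that(1)]] show ?thesis .
  qed
  have mp: "?p \<Lambda>' \<in> borel_measurable (\<Pi>\<^sub>M _\<in>?K \<Lambda>'. M)" if "\<Lambda>' \<subseteq> insert l \<Lambda>" for \<Lambda>'
    using that by (intro borel_measurable_prod_ennreal meas) auto
  have "(\<integral>\<^sup>+x. ?p (insert l \<Lambda>) x \<partial>(\<Pi>\<^sub>M _\<in>?K (insert l \<Lambda>). M)) =
      (\<integral>\<^sup>+x. \<integral>\<^sup>+y. ?p (insert l \<Lambda>) (merge (A l \<times> {l}) (?K \<Lambda>) (x, y)) \<partial>(\<Pi>\<^sub>M _\<in>?K \<Lambda>. M) \<partial>(\<Pi>\<^sub>M _\<in>A l \<times> {l}. M))"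
    using mp[of "insert l \<Lambda>"] unfolding K
    by (intro product_nn_integral_fold[OF disj fin]) simp
  \<comment> \<open>On a merged point the factor of \<open>l\<close> sees only \<open>x\<close> and
    the other factors only \<open>y\<close>.\<close>
  also have "\<dots> = (\<integral>\<^sup>+x. \<integral>\<^sup>+y. g l (\<lambda>i\<in>A l. x (i, l)) * ?p \<Lambda> y \<partial>(\<Pi>\<^sub>M _\<in>?K \<Lambda>. M) \<partial>(\<Pi>\<^sub>M _\<in>A l \<times> {l}. M))"
  proof (intro nn_integral_cong)
    fix x y :: "'t \<times> 'l \<Rightarrow> 'a"
    let ?m = "merge (A l \<times> {l}) (?K \<Lambda>) (x, y)"
    have "(\<lambda>i\<in>A l. ?m (i, l)) = (\<lambda>i\<in>A l. x (i, l))"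
      by (auto simp: merge_def)
    moreover have "(\<lambda>i\<in>A l'. ?m (i, l')) = (\<lambda>i\<in>A l'. y (i, l'))" if "l' \<in> \<Lambda>" for l'
      using that insert.hyps by (auto simp: merge_def)
    ultimately show "?p (insert l \<Lambda>) ?m = g l (\<lambda>i\<in>A l. x (i, l)) * ?p \<Lambda> y"
      using insert.hyps by simp
  qed
  also have "\<dots> = (\<integral>\<^sup>+x. g l (\<lambda>i\<in>A l. x (i, l)) \<partial>(\<Pi>\<^sub>M _\<in>A l \<times> {l}. M)) * (\<integral>\<^sup>+y. ?p \<Lambda> y \<partial>(\<Pi>\<^sub>M _\<in>?K \<Lambda>. M))"
    using mp[of \<Lambda>] meas[of l "A l \<times> {l}"] by (subst nn_integral_cmult) (auto simp: nn_integral_multc)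
  \<comment> \<open>The block of \<open>l\<close> is a copy of \<open>A l\<close> through
    \<open>i \<mapsto> (i, l)\<close>.\<close>
  also have "(\<integral>\<^sup>+x. g l (\<lambda>i\<in>A l. x (i, l)) \<partial>(\<Pi>\<^sub>M _\<in>A l \<times> {l}. M)) = (\<integral>\<^sup>+y. g l y \<partial>(\<Pi>\<^sub>M i\<in>A l. M))"
    using insert.prems
    by (intro nn_integral_PiM_reindex[OF M, symmetric]) (auto simp: bij_betw_def inj_on_def)
  also have "(\<integral>\<^sup>+y. ?p \<Lambda> y \<partial>(\<Pi>\<^sub>M _\<in>?K \<Lambda>. M)) = (\<Prod>l\<in>\<Lambda>. \<integral>\<^sup>+y. g l y \<partial>(\<Pi>\<^sub>M i\<in>A l. M))"
    by (rule insert.IH) (use insert.prems in auto)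
  finally show ?case
    using insert.hyps by simp
qed

section \<open>Non-negative series as integrals over counting measures\<close>

text \<open>For infinite \<open>S\<close> an enumeration turns both sides into the same ordinary
  series. This brings the total weight into the form of the infinite sum in the theorem.\<close>

lemma infsum_ennreal_eq_nn_integral:
  fixes f :: "'h \<Rightarrow> ennreal"
  assumes "countable S"
  shows "(\<Sum>\<^sub>\<infinity>h\<in>S. f h) = (\<integral>\<^sup>+h. f h \<partial>count_space S)"
proof (cases "finite S")
  case True
  then show ?thesis by (simp add: nn_integral_count_space_finite)
next
  case False
  note bij = bij_betw_from_nat_into[OF assms False]
  have "(\<Sum>\<^sub>\<infinity>h\<in>S. f h) = (\<Sum>\<^sub>\<infinity>n. f (from_nat_into S n))"
    by (rule infsum_reindex_bij_betw[OF bij, symmetric])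
  also have "\<dots> = (\<Sum>n. f (from_nat_into S n))"
    by (intro sums_unique has_sum_imp_sums has_sum_infsum nonneg_summable_on_complete) simp
  also have "\<dots> = (\<integral>\<^sup>+h. f h \<partial>count_space S)"
    using nn_integral_bij_count_space[OF bij, of f] by (simp add: nn_integral_count_space_nat)
  finally show ?thesis .
qed

text \<open>For non-negative terms, summability is integrability over the counting measure. In the
  divergent case the second claim reads 0 = 0, as \<open>infsum\<close> and
  \<open>enn2real \<infinity>\<close> both default to 0.\<close>

lemma
  fixes g :: "'h \<Rightarrow> real"
  assumes nn: "\<And>h. h \<in> S \<Longrightarrow> 0 \<le> g h"
  shows summable_on_iff_nn_integral: "g summable_on S \<longleftrightarrow> (\<integral>\<^sup>+h. ennreal (g h) \<partial>count_space S) \<noteq> \<infinity>"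
    and infsum_eq_enn2real_nn_integral: "infsum g S = enn2real (\<integral>\<^sup>+h. ennreal (g h) \<partial>count_space S)"
proof -
  have "(\<lambda>h. norm (g h)) summable_on S \<longleftrightarrow> g summable_on S"
    using nn by (intro summable_on_cong) simp
  then have abs: "g summable_on S \<longleftrightarrow> Infinite_Set_Sum.abs_summable_on g S"
    using abs_summable_equivalent[of g S] by simp
  have "(\<integral>\<^sup>+h. ennreal (norm (g h)) \<partial>count_space S) = (\<integral>\<^sup>+h. ennreal (g h) \<partial>count_space S)"
    using nn by (intro nn_integral_cong) simp
  then show iff: "g summable_on S \<longleftrightarrow> (\<integral>\<^sup>+h. ennreal (g h) \<partial>count_space S) \<noteq> \<infinity>"
    unfolding abs Infinite_Set_Sum.abs_summable_on_def integrable_iff_bounded by (simp add: less_top)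
  show "infsum g S = enn2real (\<integral>\<^sup>+h. ennreal (g h) \<partial>count_space S)"
  proof (cases "g summable_on S")
    case True
    then have "infsum g S = infsetsum g S"
      using abs by (simp add: infsetsum_infsum)
    then show ?thesis
      using infsetsum_conv_nn_integral[of S g] iff True nn by simp
  next
    case False
    then show ?thesis using iff by (simp add: infsum_not_exists)
  qed
qed

text \<open>Countability serves twice: it makes the integrand jointly measurable from its sections,
  and it makes the counting measure sigma-finite, so that parametrized integrals are
  measurable.\<close>

lemma borel_measurable_nn_integral_count_space:
  fixes f :: "'h \<Rightarrow> 'a \<Rightarrow> ennreal"
  assumes S: "countable S" and f: "\<And>h. h \<in> S \<Longrightarrow> f h \<in> borel_measurable N"
  shows "(\<lambda>x. \<integral>\<^sup>+h. f h x \<partial>count_space S) \<in> borel_measurable N"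
proof -
  have "(\<lambda>(x, h). f h x) \<in> borel_measurable (N \<Otimes>\<^sub>M count_space S)"
    unfolding split_def
    by (rule measurable_compose_countable'[where g = snd and I = S])
      (auto intro!: measurable_compose[OF measurable_fst f] S)
  then show ?thesis
    by (rule sigma_finite_measure.borel_measurable_nn_integral[OF sigma_finite_measure_count_space_countable[OF S]])
qed

lemma nn_integral_count_space_Diff:
  fixes f :: "'h \<Rightarrow> ennreal"
  assumes "T \<subseteq> S"
  shows "(\<integral>\<^sup>+h. f h \<partial>count_space S) = (\<integral>\<^sup>+h. f h \<partial>count_space T) + (\<integral>\<^sup>+h. f h \<partial>count_space (S - T))"
proof -
  have "(\<integral>\<^sup>+h. f h \<partial>count_space S) =
      (\<integral>\<^sup>+h. f h * indicator T h + f h * indicator (S - T) h \<partial>count_space UNIV)"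
    using assms by (subst nn_integral_count_space_indicator)
      (auto intro!: nn_integral_cong split: split_indicator)
  also have "\<dots> = (\<integral>\<^sup>+h. f h \<partial>count_space T) + (\<integral>\<^sup>+h. f h \<partial>count_space (S - T))"
    by (subst nn_integral_add) (auto simp: nn_integral_count_space_indicator)
  finally show ?thesis .
qed

subsection \<open>Trajectories\<close>

lemma labels_state_sets: "i \<in> A \<Longrightarrow> labels (state_sets A I x i) = I i"
  by (simp add: labels_def state_sets_def image_image)

lemma distinct_labels_state_sets: "i \<in> A \<Longrightarrow> distinct_labels (state_sets A I x i) = 1"
  by (simp add: distinct_labels_def labels_state_sets) (simp add: state_sets_def card_image inj_on_def)

lemma state_of_state_sets: "i \<in> A \<Longrightarrow> l \<in> I i \<Longrightarrow> state_of (state_sets A I x i) l = x (i, l)"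
  unfolding state_of_def by (rule the_equality) (auto simp: state_sets_def)

lemma ms_distinct_labels_state_sets: "ms_distinct_labels j k (state_sets {j..k} I x) = 1"
  by (simp add: ms_distinct_labels_def distinct_labels_state_sets)

lemma ms_labels_state_sets:
  assumes "I \<in> extensional {j..k}"
  shows "ms_labels j k (state_sets {j..k} I x) = I"
  using assms by (auto simp: ms_labels_def labels_state_sets fun_eq_iff extensional_def)

text \<open>The sum that defines \<open>traj_end\<close> has \<open>k - traj_start j l\<close>
  terms, each at most 1. For a start after \<open>k\<close> it is empty and the end is the start
  itself, hence the assumption.\<close>

lemma traj_end_le:
  assumes "traj_start j l \<le> k"
  shows "traj_end j k I l \<le> k"
proof -
  have "(\<Sum>i=Suc (traj_start j l)..k. of_bool (l \<in> I i)) \<le> (\<Sum>i=Suc (traj_start j l)..k. 1::nat)"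
    by (intro sum_mono) simp
  then show ?thesis
    using assms by (simp add: traj_end_def)
qed

abbreviation lifetime :: "nat \<Rightarrow> nat \<Rightarrow> (nat \<Rightarrow> 'b label set) \<Rightarrow> 'b label \<Rightarrow> nat set" where
  "lifetime j k I l \<equiv> {traj_start j l..traj_end j k I l}"

text \<open>A label of the union is present at some time \<open>i \<le> k\<close>, which lies in its
  lifetime; this bounds the start by \<open>k\<close>, and then the end as well.\<close>

lemma trajectory_labelsD:
  assumes "trajectory_labels j k I" and "l \<in> (\<Union>i\<in>{j..k}. I i)"
  shows traj_start_le: "traj_start j l \<le> k"
    and lifetime_subset: "lifetime j k I l \<subseteq> {j..k}"
    and mem_iff_lifetime: "\<And>i. i \<in> {j..k} \<Longrightarrow> l \<in> I i \<longleftrightarrow> i \<in> lifetime j k I l"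
proof -
  show iff: "\<And>i. i \<in> {j..k} \<Longrightarrow> l \<in> I i \<longleftrightarrow> i \<in> lifetime j k I l"
    using assms unfolding trajectory_labels_def by blast
  obtain i where i: "i \<in> {j..k}" "l \<in> I i"
    using assms(2) by auto
  then have "i \<in> lifetime j k I l"
    using iff by blast
  with i show le: "traj_start j l \<le> k"
    by auto
  have "j \<le> traj_start j l" by (simp add: traj_start_def)
  with traj_end_le[OF le, of I] show "lifetime j k I l \<subseteq> {j..k}"
    by auto
qed

text \<open>Regroups the time-label pairs by label: this is the index set on which
  \<open>nn_integral_PiM_prod_slices\<close> factorizes integrals.\<close>

lemma Sigma_eq_lifetimes:
  assumes "trajectory_labels j k I"
  shows "Sigma {j..k} I = {(i, l). l \<in> (\<Union>i\<in>{j..k}. I i) \<and> i \<in> lifetime j k I l}"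
proof (intro set_eqI iffI)
  fix z assume "z \<in> Sigma {j..k} I"
  then obtain i l where z: "z = (i, l)" "i \<in> {j..k}" "l \<in> I i"
    by auto
  then have "l \<in> (\<Union>i\<in>{j..k}. I i)" by blast
  moreover from mem_iff_lifetime[OF assms this z(2)] z have "i \<in> lifetime j k I l"
    by simp
  ultimately show "z \<in> {(i, l). l \<in> (\<Union>i\<in>{j..k}. I i) \<and> i \<in> lifetime j k I l}"
    using z by simp
next
  fix z assume "z \<in> {(i, l). l \<in> (\<Union>i\<in>{j..k}. I i) \<and> i \<in> lifetime j k I l}"
  then obtain i l where z: "z = (i, l)" and l: "l \<in> (\<Union>i\<in>{j..k}. I i)" and i: "i \<in> lifetime j k I l"
    by auto
  have "i \<in> {j..k}"
    using lifetime_subset[OF assms l] i by blast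
  with mem_iff_lifetime[OF assms l] i z show "z \<in> Sigma {j..k} I"
    by simp
qed

text \<open>The inner restriction to the lifetime changes no entry of the list, but exhibits each
  factor as a function of the slice of \<open>x\<close> that belongs to one label.\<close>

lemma ms_exp_state_sets:
  assumes I: "I \<in> extensional {j..k}" and traj: "trajectory_labels j k I"
  shows "ms_exp j k h (state_sets {j..k} I x) = (\<Prod>l\<in>(\<Union>i\<in>{j..k}. I i).
    h (map (\<lambda>i. ((\<lambda>i\<in>lifetime j k I l. x (i, l)) i, l)) [traj_start j l..<Suc (traj_end j k I l)]))"
proof -
  have "trajectory j k (state_sets {j..k} I x) l =
      map (\<lambda>i. ((\<lambda>i\<in>lifetime j k I l. x (i, l)) i, l)) [traj_start j l..<Suc (traj_end j k I l)]"
    if l: "l \<in> (\<Union>i\<in>{j..k}. I i)" for l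
    unfolding trajectory_def ms_labels_state_sets[OF I]
  proof (rule map_cong[OF refl])
    fix i assume "i \<in> set [traj_start j l..<Suc (traj_end j k I l)]"
    then have i: "i \<in> lifetime j k I l" by auto
    then have i': "i \<in> {j..k}"
      using lifetime_subset[OF traj l] by blast
    with i mem_iff_lifetime[OF traj l] have "l \<in> I i" by blast
    with i i' show "(state_of (state_sets {j..k} I x i) l, l) = ((\<lambda>i\<in>lifetime j k I l. x (i, l)) i, l)"
      by (simp add: state_of_state_sets)
  qed
  then show ?thesis
    by (simp add: ms_exp_def labels_state_sets)
qed

subsection \<open>The terms of a GLMB series integrate to their weights\<close>

text \<open>\<open>density\<close> ranges over every end time \<open>t\<close> up to
  \<open>k\<close>, since the end of a trajectory depends on the label sequence;
  \<open>weight_eq_0\<close> discards the sequences that do not describe trajectories.\<close>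

locale ms_GLMB_model =
  fixes M :: "'a measure"
    and B :: "nat \<Rightarrow> 'b label set"
    and j k :: nat
    and \<Xi> :: "'xi set"
    and w :: "'xi \<Rightarrow> (nat \<Rightarrow> 'b label set) \<Rightarrow> real"
    and p :: "'xi \<Rightarrow> ('a \<times> 'b label) list \<Rightarrow> real"
  assumes sigma_finite: "sigma_finite_measure M" and diffuse: "diffuse M"
    and finite_births: "\<And>s. finite (B s)"
    and countable_index: "countable \<Xi>"
    and weight_nonneg: "\<And>\<xi> I. \<xi> \<in> \<Xi> \<Longrightarrow> I \<in> label_seqs j k B \<Longrightarrow> 0 \<le> w \<xi> I"
    and weight_eq_0: "\<And>\<xi> I. \<xi> \<in> \<Xi> \<Longrightarrow> I \<in> label_seqs j k B \<Longrightarrow> \<not> trajectory_labels j k I \<Longrightarrow> w \<xi> I = 0"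
    and density: "\<And>\<xi> l t. \<xi> \<in> \<Xi> \<Longrightarrow> l \<in> label_space B k \<Longrightarrow> t \<in> {traj_start j l..k} \<Longrightarrow>
           prob_density (\<Pi>\<^sub>M i\<in>{traj_start j l..t}. M)
             (\<lambda>x. p \<xi> (map (\<lambda>i. (x i, l)) [traj_start j l..<Suc t]))"
begin

abbreviation hyps :: "('xi \<times> (nat \<Rightarrow> 'b label set)) set" where
  "hyps \<equiv> \<Xi> \<times> label_seqs j k B"

abbreviation states :: "(nat \<Rightarrow> 'b label set) \<Rightarrow> (nat \<times> 'b label \<Rightarrow> 'a) \<Rightarrow> nat \<Rightarrow> ('a \<times> 'b label) set" where
  "states I x \<equiv> state_sets {j..k} I x"

abbreviation state_space :: "(nat \<Rightarrow> 'b label set) \<Rightarrow> (nat \<times> 'b label \<Rightarrow> 'a) measure" where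
  "state_space I \<equiv> \<Pi>\<^sub>M _\<in>Sigma {j..k} I. M"

lemma finite_label_space: "finite (label_space B i)"
  by (simp add: label_space_def finite_births)

lemma label_seqs_eq: "label_seqs j k B = (\<Pi>\<^sub>E i\<in>{j..k}. Pow (label_space B i))"
  unfolding label_seqs_def
  by (intro PiE_cong) (auto simp: Fpow_def intro: finite_subset[OF _ finite_label_space])

lemma finite_label_seqs: "finite (label_seqs j k B)"
  unfolding label_seqs_eq by (intro finite_PiE) (auto simp: finite_label_space)

lemma countable_hyps: "S \<subseteq> hyps \<Longrightarrow> countable S"
  by (rule countable_subset[of _ hyps]) (auto intro: countable_index countable_finite finite_label_seqs)

lemma label_seqs_extensional: "I \<in> label_seqs j k B \<Longrightarrow> I \<in> extensional {j..k}"
  by (simp add: label_seqs_eq PiE_iff)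

lemma label_seqs_Union: "I \<in> label_seqs j k B \<Longrightarrow> (\<Union>i\<in>{j..k}. I i) \<subseteq> label_space B k"
  by (auto simp: label_seqs_eq label_space_def PiE_iff) fastforce

lemma ms_nn_integral_eq_sum:
  assumes "\<And>X i. i \<in> {j..k} \<Longrightarrow> distinct_labels (X i) = 0 \<Longrightarrow> F X = 0"
    and "\<And>I. I \<in> label_seqs j k B \<Longrightarrow> (\<lambda>x. F (states I x)) \<in> borel_measurable (state_space I)"
  shows "ms_nn_integral M B j k F = (\<Sum>I\<in>label_seqs j k B. \<integral>\<^sup>+x. F (states I x) \<partial>state_space I)"
proof -
  have set: "set [j..<Suc k] = {j..k}" by auto
  show ?thesis
    unfolding ms_nn_integral_def label_seqs_eq set[symmetric]
    by (rule iter_set_nn_integral_eq_sum[OF sigma_finite diffuse])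
      (use assms in \<open>auto simp only: set distinct_upt finite_label_space label_seqs_eq\<close>)
qed

text \<open>If \<open>I'\<close> differs from \<open>I\<close>, the label indicator kills the term;
  if \<open>I\<close> does not describe trajectories, the weight does. Otherwise the time-label
  pairs split into lifetimes, and each density integrates to 1.\<close>

lemma
  assumes h: "(\<xi>, I') \<in> hyps" and I: "I \<in> label_seqs j k B"
  shows term_nonneg: "x \<in> space (state_space I) \<Longrightarrow> 0 \<le> ms_GLMB_term j k w p (states I x) (\<xi>, I')"
    and term_measurable: "(\<lambda>x. ms_GLMB_term j k w p (states I x) (\<xi>, I')) \<in> borel_measurable (state_space I)"
    and term_integral: "(\<integral>\<^sup>+x. ennreal (ms_GLMB_term j k w p (states I x) (\<xi>, I')) \<partial>state_space I) =
      ennreal (w \<xi> I') * of_bool (I' = I)"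
proof -
  note ext = label_seqs_extensional[OF I]
  let ?term = "\<lambda>x. ms_GLMB_term j k w p (states I x) (\<xi>, I')"
  have "(\<forall>x\<in>space (state_space I). 0 \<le> ?term x) \<and> ?term \<in> borel_measurable (state_space I) \<and>
    (\<integral>\<^sup>+x. ennreal (?term x) \<partial>state_space I) = ennreal (w \<xi> I') * of_bool (I' = I)"
  proof (cases "I' = I \<and> trajectory_labels j k I")
    case False
    then have term_eq: "?term x = 0" and w: "ennreal (w \<xi> I') * of_bool (I' = I) = 0" for x
      using h I weight_eq_0 by (auto simp: ms_GLMB_term_def ms_labels_state_sets[OF ext])
    show ?thesis unfolding term_eq w by simp
  next
    case True
    then have I'[simp]: "I' = I" and traj: "trajectory_labels j k I" by auto
    let ?\<Lambda> = "\<Union>i\<in>{j..k}. I i" and ?A = "lifetime j k I"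
    define g where "g l y = p \<xi> (map (\<lambda>i. (y i, l)) [traj_start j l..<Suc (traj_end j k I l)])" for l y
    have \<xi>: "\<xi> \<in> \<Xi>" and w: "0 \<le> w \<xi> I"
      using h I weight_nonneg by auto
    have fin: "finite ?\<Lambda>"
      using label_seqs_Union[OF I] finite_label_space finite_subset by blast
    \<comment> \<open>The density hypothesis is used with \<open>t\<close> the end of the trajectory
      of \<open>l\<close> in \<open>I\<close>.\<close>
    have g: "prob_density (\<Pi>\<^sub>M i\<in>?A l. M) (g l)" if l: "l \<in> ?\<Lambda>" for l
    proof -
      have "traj_start j l \<le> traj_end j k I l" by (simp add: traj_end_def)
      moreover have "traj_end j k I l \<le> k"
        by (rule traj_end_le) (rule traj_start_le[OF traj l])
      ultimately show ?thesis
        unfolding g_def using label_seqs_Union[OF I] l by (intro density \<xi>) auto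
    qed
    have term_eq: "?term x = w \<xi> I * (\<Prod>l\<in>?\<Lambda>. g l (\<lambda>i\<in>?A l. x (i, l)))" for x
      by (simp add: ms_GLMB_term_def ms_labels_state_sets[OF ext] ms_exp_state_sets[OF ext traj] g_def)
    have sub: "?A l \<times> {l} \<subseteq> Sigma {j..k} I" if "l \<in> ?\<Lambda>" for l
      using that unfolding Sigma_eq_lifetimes[OF traj] by blast
    have r: "(\<lambda>x. \<lambda>i\<in>?A l. x (i, l)) \<in> measurable (state_space I) (\<Pi>\<^sub>M i\<in>?A l. M)" if "l \<in> ?\<Lambda>" for l
      by (intro measurable_restrict measurable_component_singleton subsetD[OF sub[OF that]]) simp
    \<comment> \<open>Densities are assumed non-negative on the space only, so it matters that a
      slice of a point of the product space lies in the space of the density.\<close>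
    have nonneg: "0 \<le> g l (\<lambda>i\<in>?A l. x (i, l))" if "l \<in> ?\<Lambda>" "x \<in> space (state_space I)" for l x
      using g[OF that(1)] measurable_space[OF r that(2)] that(1) unfolding prob_density_def by blast
    have gr: "(\<lambda>x. g l (\<lambda>i\<in>?A l. x (i, l))) \<in> borel_measurable (state_space I)" if "l \<in> ?\<Lambda>" for l
      using g[OF that] unfolding prob_density_def by (intro measurable_compose[OF r[OF that]]) simp
    have "(\<integral>\<^sup>+x. ennreal (?term x) \<partial>state_space I) =
        (\<integral>\<^sup>+x. ennreal (w \<xi> I) * (\<Prod>l\<in>?\<Lambda>. ennreal (g l (\<lambda>i\<in>?A l. x (i, l)))) \<partial>state_space I)"
      unfolding term_eq
    proof (rule nn_integral_cong)
      fix x assume "x \<in> space (state_space I)"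
      note nonneg = nonneg[OF _ this]
      have "(\<Prod>l\<in>?\<Lambda>. ennreal (g l (\<lambda>i\<in>?A l. x (i, l)))) =
          ennreal (\<Prod>l\<in>?\<Lambda>. g l (\<lambda>i\<in>?A l. x (i, l)))"
        by (rule prod_ennreal) (rule nonneg)
      moreover have "0 \<le> (\<Prod>l\<in>?\<Lambda>. g l (\<lambda>i\<in>?A l. x (i, l)))"
        by (rule prod_nonneg) (rule nonneg)
      ultimately show "ennreal (w \<xi> I * (\<Prod>l\<in>?\<Lambda>. g l (\<lambda>i\<in>?A l. x (i, l)))) =
          ennreal (w \<xi> I) * (\<Prod>l\<in>?\<Lambda>. ennreal (g l (\<lambda>i\<in>?A l. x (i, l))))"
        using w by (simp only: ennreal_mult)
    qed
    also have "\<dots> = ennreal (w \<xi> I) * (\<integral>\<^sup>+x. (\<Prod>l\<in>?\<Lambda>. ennreal (g l (\<lambda>i\<in>?A l. x (i, l)))) \<partial>state_space I)"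
      using gr by (intro nn_integral_cmult borel_measurable_prod_ennreal) auto
    also have "(\<integral>\<^sup>+x. (\<Prod>l\<in>?\<Lambda>. ennreal (g l (\<lambda>i\<in>?A l. x (i, l)))) \<partial>state_space I) =
        (\<Prod>l\<in>?\<Lambda>. \<integral>\<^sup>+y. ennreal (g l y) \<partial>(\<Pi>\<^sub>M i\<in>?A l. M))"
      unfolding Sigma_eq_lifetimes[OF traj]
      using fin g by (intro nn_integral_PiM_prod_slices[OF sigma_finite]) (auto simp: prob_density_def)
    also have "\<dots> = 1"
      using g by (intro prod.neutral) (auto simp: prob_density_def)
    finally show ?thesis
      unfolding term_eq using nonneg w gr by (auto intro!: mult_nonneg_nonneg prod_nonneg)
  qed
  then show "x \<in> space (state_space I) \<Longrightarrow> 0 \<le> ?term x"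
    and "?term \<in> borel_measurable (state_space I)"
    and "(\<integral>\<^sup>+x. ennreal (?term x) \<partial>state_space I) = ennreal (w \<xi> I') * of_bool (I' = I)"
    by blast+
qed

text \<open>Unlike the real infinite sum in \<open>ms_GLMB\<close>, which is \<open>0\<close> when it diverges, this is \<open>\<infinity>\<close> there.\<close>
definition term_series :: "('xi \<times> (nat \<Rightarrow> 'b label set)) set \<Rightarrow> (nat \<Rightarrow> 'b label set) \<Rightarrow>
    (nat \<times> 'b label \<Rightarrow> 'a) \<Rightarrow> ennreal" where
  "term_series S I x = (\<integral>\<^sup>+h. ennreal (ms_GLMB_term j k w p (states I x) h) \<partial>count_space S)"

lemma term_series_measurable [measurable]:
  assumes "S \<subseteq> hyps" "I \<in> label_seqs j k B"
  shows "term_series S I \<in> borel_measurable (state_space I)"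
  unfolding term_series_def[abs_def]
proof (rule borel_measurable_nn_integral_count_space[OF countable_hyps[OF assms(1)]])
  fix h assume "h \<in> S"
  then have "(fst h, snd h) \<in> hyps" using assms(1) by auto
  from term_measurable[OF this assms(2)]
  show "(\<lambda>x. ennreal (ms_GLMB_term j k w p (states I x) h)) \<in> borel_measurable (state_space I)"
    by simp
qed

text \<open>The labels of \<open>states I x\<close> are distinct at each time, and non-negative
  terms make the series an integral over the counting measure. The second claim survives divergence,
  where both sides are 0.\<close>

lemma
  assumes "S \<subseteq> hyps" "I \<in> label_seqs j k B" "x \<in> space (state_space I)"
  shows term_summable_iff: "ms_GLMB_term j k w p (states I x) summable_on S \<longleftrightarrow> term_series S I x \<noteq> \<infinity>"
    and ms_GLMB_states: "ms_GLMB j k w p S (states I x) = enn2real (term_series S I x)"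
proof -
  have "0 \<le> ms_GLMB_term j k w p (states I x) h" if "h \<in> S" for h
    using term_nonneg[OF _ assms(2,3), of "fst h" "snd h"] assms(1) that by auto
  note nonneg = this
  show "ms_GLMB_term j k w p (states I x) summable_on S \<longleftrightarrow> term_series S I x \<noteq> \<infinity>"
    unfolding term_series_def by (rule summable_on_iff_nn_integral) (rule nonneg)
  show "ms_GLMB j k w p S (states I x) = enn2real (term_series S I x)"
    using infsum_eq_enn2real_nn_integral[of S "ms_GLMB_term j k w p (states I x)"] nonneg
    by (simp add: ms_GLMB_def ms_distinct_labels_state_sets term_series_def)
qed

definition total_weight :: "('xi \<times> (nat \<Rightarrow> 'b label set)) set \<Rightarrow> ennreal" where
  "total_weight S = (\<integral>\<^sup>+h. ennreal (w (fst h) (snd h)) \<partial>count_space S)"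

text \<open>Non-negativity and countability let series and integral be exchanged; each hypothesis
  \<open>h\<close> then contributes its weight to the one summand \<open>I = snd h\<close> and 0 to
  the others.\<close>

lemma sum_integral_term_series:
  assumes "S \<subseteq> hyps"
  shows "(\<Sum>I\<in>label_seqs j k B. \<integral>\<^sup>+x. term_series S I x \<partial>state_space I) = total_weight S"
proof -
  have "(\<integral>\<^sup>+x. term_series S I x \<partial>state_space I) =
      (\<integral>\<^sup>+h. ennreal (w (fst h) (snd h)) * of_bool (snd h = I) \<partial>count_space S)"
    if I: "I \<in> label_seqs j k B" for I
  proof -
    have h: "(fst h, snd h) \<in> hyps" if "h \<in> S" for h
      using that assms by auto
    have "(\<integral>\<^sup>+x. term_series S I x \<partial>state_space I) =
        (\<integral>\<^sup>+h. \<integral>\<^sup>+x. ennreal (ms_GLMB_term j k w p (states I x) h) \<partial>state_space I \<partial>count_space S)"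
      unfolding term_series_def using term_measurable[OF h I]
      by (intro nn_integral_count_space_nn_integral countable_hyps assms) simp
    also have "\<dots> = (\<integral>\<^sup>+h. ennreal (w (fst h) (snd h)) * of_bool (snd h = I) \<partial>count_space S)"
      using term_integral[OF h I] by (intro nn_integral_cong) simp
    finally show ?thesis .
  qed
  then have "(\<Sum>I\<in>label_seqs j k B. \<integral>\<^sup>+x. term_series S I x \<partial>state_space I) =
      (\<Sum>I\<in>label_seqs j k B. \<integral>\<^sup>+h. ennreal (w (fst h) (snd h)) * of_bool (snd h = I) \<partial>count_space S)"
    by (rule sum.cong[OF refl])
  also have "\<dots> = (\<integral>\<^sup>+h. (\<Sum>I\<in>label_seqs j k B. ennreal (w (fst h) (snd h)) * of_bool (snd h = I)) \<partial>count_space S)"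
    by (rule nn_integral_sum[symmetric]) simp
  also have "\<dots> = total_weight S"
    unfolding total_weight_def
  proof (rule nn_integral_cong)
    fix h assume "h \<in> space (count_space S)"
    then have "snd h \<in> label_seqs j k B" using assms by auto
    then show "(\<Sum>I\<in>label_seqs j k B. ennreal (w (fst h) (snd h)) * of_bool (snd h = I)) = ennreal (w (fst h) (snd h))"
      using finite_label_seqs by (simp add: sum_distrib_left[symmetric] of_bool_def sum.delta)
  qed
  finally show ?thesis .
qed

lemma term_series_Diff: "T \<subseteq> S \<Longrightarrow> term_series S I x = term_series T I x + term_series (S - T) I x"
  unfolding term_series_def by (rule nn_integral_count_space_Diff)

lemma ms_GLMB_eq_0:
  assumes "i \<in> {j..k}" "distinct_labels (X i) = 0"
  shows "ms_distinct_labels j k X = 0" and "ms_GLMB j k w p S X = 0"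
proof -
  show "ms_distinct_labels j k X = 0"
    unfolding ms_distinct_labels_def using assms by (intro prod_zero) auto
  then show "ms_GLMB j k w p S X = 0"
    by (simp add: ms_GLMB_def)
qed

section \<open>Norms of GLMB series and of their differences\<close>

text \<open>The function \<open>\<phi>\<close> covers the difference, the single density and the
  normalized difference at once. \<open>\<phi> 0 0 = 0\<close> makes the integrand vanish on
  repeated labels, which the expansion over label sequences requires.\<close>

lemma ms_L1_norm_eq_sum:
  fixes \<phi> :: "real \<Rightarrow> real \<Rightarrow> real"
  assumes "S \<subseteq> hyps" "T \<subseteq> hyps" and "\<phi> 0 0 = 0"
    and \<phi>: "(\<lambda>(u, v). \<phi> u v) \<in> borel_measurable (borel \<Otimes>\<^sub>M borel)"
  shows "ms_L1_norm M B j k (\<lambda>X. \<phi> (ms_GLMB j k w p S X) (ms_GLMB j k w p T X)) =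
    (\<Sum>I\<in>label_seqs j k B. \<integral>\<^sup>+x. ennreal \<bar>\<phi> (enn2real (term_series S I x)) (enn2real (term_series T I x))\<bar> \<partial>state_space I)"
proof -
  let ?F = "\<lambda>X. ennreal \<bar>\<phi> (ms_GLMB j k w p S X) (ms_GLMB j k w p T X)\<bar>"
  let ?G = "\<lambda>I x. ennreal \<bar>\<phi> (enn2real (term_series S I x)) (enn2real (term_series T I x))\<bar>"
  have FG: "?F (states I x) = ?G I x" if "I \<in> label_seqs j k B" "x \<in> space (state_space I)" for I x
    using that assms by (simp add: ms_GLMB_states)
  have "?G I \<in> borel_measurable (state_space I)" if I: "I \<in> label_seqs j k B" for I
  proof -
    note [measurable] = term_series_measurable[OF assms(1) I] term_series_measurable[OF assms(2) I]
    have "(\<lambda>x. (enn2real (term_series S I x), enn2real (term_series T I x))) \<in> measurable (state_space I) (borel \<Otimes>\<^sub>M borel)"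
      by measurable
    from measurable_compose[OF this \<phi>] show ?thesis by simp
  qed
  then have "(\<lambda>x. ?F (states I x)) \<in> borel_measurable (state_space I)" if "I \<in> label_seqs j k B" for I
    using that by (subst measurable_cong[OF FG]) auto
  then have "ms_L1_norm M B j k (\<lambda>X. \<phi> (ms_GLMB j k w p S X) (ms_GLMB j k w p T X)) =
      (\<Sum>I\<in>label_seqs j k B. \<integral>\<^sup>+x. ?F (states I x) \<partial>state_space I)"
    unfolding ms_L1_norm_def using \<open>\<phi> 0 0 = 0\<close>
    by (intro ms_nn_integral_eq_sum) (auto simp: ms_GLMB_eq_0)
  also have "\<dots> = (\<Sum>I\<in>label_seqs j k B. \<integral>\<^sup>+x. ?G I x \<partial>state_space I)"
    using FG by (intro sum.cong nn_integral_cong) auto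
  finally show ?thesis .
qed

text \<open>The integral in \<open>ms_GLMB_converges\<close> expands into a sum over label sequences
  of the measures of the divergence sets; being non-negative with sum 0, these measures are all
  0.\<close>

lemma AE_term_series_finite:
  assumes S: "S \<subseteq> hyps" and conv: "ms_GLMB_converges M B j k w p S" and I: "I \<in> label_seqs j k B"
  shows "AE x in state_space I. term_series S I x \<noteq> \<infinity>"
proof -
  let ?F = "\<lambda>X. of_bool (ms_distinct_labels j k X = 1 \<and> \<not> ms_GLMB_term j k w p X summable_on S) :: ennreal"
  \<comment> \<open>The indicator of divergence becomes that of the value
    \<open>\<infinity>\<close>, since the labels of \<open>states I x\<close> are distinct at each
    time.\<close>
  have F: "?F (states I x) = indicator {\<infinity>} (term_series S I x)"
    if "I \<in> label_seqs j k B" "x \<in> space (state_space I)" for I x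
    using that by (simp add: ms_distinct_labels_state_sets term_summable_iff[OF S] indicator_def)
  have meas: "(\<lambda>x. indicator {\<infinity>} (term_series S I x) :: ennreal) \<in> borel_measurable (state_space I)"
    if "I \<in> label_seqs j k B" for I
    using term_series_measurable[OF S that] by measurable
  have "0 = ms_nn_integral M B j k ?F"
    using conv by (simp add: ms_GLMB_converges_def)
  also have "\<dots> = (\<Sum>I\<in>label_seqs j k B. \<integral>\<^sup>+x. ?F (states I x) \<partial>state_space I)"
  proof (rule ms_nn_integral_eq_sum)
    fix X :: "nat \<Rightarrow> ('a \<times> 'b label) set" and i
    assume "i \<in> {j..k}" "distinct_labels (X i) = 0"
    from ms_GLMB_eq_0(1)[of i X, OF this] show "?F X = 0" by simp
  next
    fix I assume "I \<in> label_seqs j k B"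
    then show "(\<lambda>x. ?F (states I x)) \<in> borel_measurable (state_space I)"
      using meas by (subst measurable_cong[OF F]) auto
  qed
  also have "\<dots> = (\<Sum>I\<in>label_seqs j k B. \<integral>\<^sup>+x. indicator {\<infinity>} (term_series S I x) \<partial>state_space I)"
    using F by (intro sum.cong nn_integral_cong) auto
  finally have "(\<integral>\<^sup>+x. indicator {\<infinity>} (term_series S I x) \<partial>state_space I) = 0"
    using finite_label_seqs I by simp
  then have "AE x in state_space I. indicator {\<infinity>} (term_series S I x) = (0::ennreal)"
    using meas[OF I] by (simp add: nn_integral_0_iff_AE)
  then show ?thesis
    by eventually_elim (auto simp: indicator_def split: if_splits)
qed

text \<open>Almost everywhere the series over \<open>S\<close> is finite, so the real difference is
  exactly the series over \<open>S - T\<close>, which is non-negative and can be integrated term by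
  term.\<close>

lemma ms_L1_norm_Diff:
  assumes S: "S \<subseteq> hyps" and conv: "ms_GLMB_converges M B j k w p S" and T: "T \<subseteq> S"
  shows "ms_L1_norm M B j k (\<lambda>X. ms_GLMB j k w p S X - ms_GLMB j k w p T X) = total_weight (S - T)"
proof -
  have "ms_L1_norm M B j k (\<lambda>X. ms_GLMB j k w p S X - ms_GLMB j k w p T X) =
      (\<Sum>I\<in>label_seqs j k B. \<integral>\<^sup>+x. ennreal \<bar>enn2real (term_series S I x) - enn2real (term_series T I x)\<bar> \<partial>state_space I)"
    using S T by (intro ms_L1_norm_eq_sum) auto
  also have "\<dots> = (\<Sum>I\<in>label_seqs j k B. \<integral>\<^sup>+x. term_series (S - T) I x \<partial>state_space I)"
  proof (intro sum.cong[OF refl] nn_integral_cong_AE)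
    fix I assume "I \<in> label_seqs j k B"
    from AE_term_series_finite[OF S conv this]
    show "AE x in state_space I. ennreal \<bar>enn2real (term_series S I x) - enn2real (term_series T I x)\<bar> = term_series (S - T) I x"
    proof eventually_elim
      case (elim x)
      then show ?case
        unfolding term_series_Diff[OF T, of I x]
        by (cases "term_series T I x"; cases "term_series (S - T) I x") (auto simp: enn2real_plus)
    qed
  qed
  also have "\<dots> = total_weight (S - T)"
    using S by (intro sum_integral_term_series) auto
  finally show ?thesis .
qed

text \<open>Almost everywhere convergence over \<open>S\<close> passes to the subseries over
  \<open>T\<close>; the case \<open>T = S\<close> gives the norm of the full series.\<close>

lemma ms_L1_norm_eq_total_weight:
  assumes S: "S \<subseteq> hyps" and conv: "ms_GLMB_converges M B j k w p S" and T: "T \<subseteq> S"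
  shows "ms_L1_norm M B j k (ms_GLMB j k w p T) = total_weight T"
proof -
  have T': "T \<subseteq> hyps" using S T by blast
  have "ms_L1_norm M B j k (ms_GLMB j k w p T) =
      (\<Sum>I\<in>label_seqs j k B. \<integral>\<^sup>+x. ennreal \<bar>enn2real (term_series T I x)\<bar> \<partial>state_space I)"
    \<comment> \<open>The integrand involves one series only, so \<open>T\<close> fills both places
      and \<open>\<phi>\<close> is the first projection.\<close>
    using ms_L1_norm_eq_sum[OF T' T', of "\<lambda>u v. u"] by simp
  also have "\<dots> = (\<Sum>I\<in>label_seqs j k B. \<integral>\<^sup>+x. term_series T I x \<partial>state_space I)"
  proof (intro sum.cong[OF refl] nn_integral_cong_AE)
    fix I assume "I \<in> label_seqs j k B"
    from AE_term_series_finite[OF S conv this]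
    show "AE x in state_space I. ennreal \<bar>enn2real (term_series T I x)\<bar> = term_series T I x"
      by eventually_elim (auto simp: term_series_Diff[OF T] less_top)
  qed
  also have "\<dots> = total_weight T"
    by (rule sum_integral_term_series[OF T'])
  finally show ?thesis .
qed

text \<open>The triangle inequality separates the excess series over \<open>S - T\<close> from the
  rescaling of the common one; each bound integrates to \<open>(a - b) / a\<close>, whence the
  factor 2.\<close>

lemma ms_L1_norm_normalized_le:
  assumes S: "S \<subseteq> hyps" and conv: "ms_GLMB_converges M B j k w p S" and T: "T \<subseteq> S"
    and a: "total_weight S = ennreal a" and b: "total_weight T = ennreal b" and pos: "0 < a" "0 < b"
  shows "ms_L1_norm M B j k (\<lambda>X. ms_GLMB j k w p S X / a - ms_GLMB j k w p T X / b) \<le> ennreal (2 * ((a - b) / a))"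
proof -
  have T': "T \<subseteq> hyps" and D: "S - T \<subseteq> hyps" using S T by auto
  have mass: "total_weight S = total_weight T + total_weight (S - T)"
    unfolding total_weight_def by (rule nn_integral_count_space_Diff[OF T])
  then have "total_weight T \<le> total_weight S" by simp
  then have ab: "b \<le> a"
    using a b pos by simp
  \<comment> \<open>All masses are finite, so the mass of \<open>T\<close> can be subtracted from
    that of \<open>S\<close>.\<close>
  have massD: "total_weight (S - T) = ennreal (a - b)"
    using mass a b pos ab
    by (cases "total_weight (S - T)") (auto simp: ennreal_plus[symmetric] simp del: ennreal_plus)
  define c where "c = 1 / b - 1 / a"
  have c: "0 \<le> c" using ab pos by (simp add: c_def frac_le)
  have "ms_L1_norm M B j k (\<lambda>X. ms_GLMB j k w p S X / a - ms_GLMB j k w p T X / b) =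
      (\<Sum>I\<in>label_seqs j k B. \<integral>\<^sup>+x. ennreal \<bar>enn2real (term_series S I x) / a - enn2real (term_series T I x) / b\<bar> \<partial>state_space I)"
    by (intro ms_L1_norm_eq_sum[OF S T', of "\<lambda>u v. u / a - v / b"]) auto
  also have "\<dots> \<le> (\<Sum>I\<in>label_seqs j k B. \<integral>\<^sup>+x. term_series (S - T) I x * ennreal (1 / a) + term_series T I x * ennreal c \<partial>state_space I)"
  proof (intro sum_mono nn_integral_mono_AE)
    fix I assume "I \<in> label_seqs j k B"
    from AE_term_series_finite[OF S conv this]
    show "AE x in state_space I. ennreal \<bar>enn2real (term_series S I x) / a - enn2real (term_series T I x) / b\<bar> \<le>
        term_series (S - T) I x * ennreal (1 / a) + term_series T I x * ennreal c"
    proof eventually_elim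
      case (elim x)
      then obtain d t where d: "0 \<le> d" "term_series (S - T) I x = ennreal d" and t: "0 \<le> t" "term_series T I x = ennreal t"
        unfolding term_series_Diff[OF T, of I x] by (cases "term_series T I x"; cases "term_series (S - T) I x") auto
      \<comment> \<open>With \<open>d\<close> the series over \<open>S - T\<close> and
        \<open>t\<close> that over \<open>T\<close>, the series over \<open>S\<close> is
        \<open>t + d\<close>; collecting \<open>t\<close> leaves the coefficient
        \<open>1 / a - 1 / b = - c\<close>.\<close>
      have "\<bar>(t + d) / a - t / b\<bar> = \<bar>d * (1 / a) - t * c\<bar>"
        by (simp add: c_def add_divide_distrib right_diff_distrib)
      also have "\<dots> \<le> d * (1 / a) + t * c"
        using d t c pos by (intro abs_leI) auto
      finally show ?case
        unfolding term_series_Diff[OF T, of I x] using d t c pos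
        by (simp add: ennreal_mult[symmetric] ennreal_plus[symmetric] ennreal_leI del: ennreal_plus)
    qed
  qed
  also have "\<dots> = (\<Sum>I\<in>label_seqs j k B. (\<integral>\<^sup>+x. term_series (S - T) I x \<partial>state_space I) * ennreal (1 / a) +
      (\<integral>\<^sup>+x. term_series T I x \<partial>state_space I) * ennreal c)"
    using term_series_measurable[OF D] term_series_measurable[OF T']
    by (intro sum.cong[OF refl]) (simp add: nn_integral_add nn_integral_multc)
  also have "\<dots> = total_weight (S - T) * ennreal (1 / a) + total_weight T * ennreal c"
    by (simp add: sum.distrib sum_distrib_right[symmetric] sum_integral_term_series[OF D] sum_integral_term_series[OF T'])
  also have "\<dots> = ennreal ((a - b) * (1 / a) + b * c)"
    unfolding massD b using pos ab c by (simp add: ennreal_mult[symmetric] ennreal_plus[symmetric] del: ennreal_plus)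
  \<comment> \<open>\<open>b * c = 1 - b / a = (a - b) / a\<close>, so both contributions are
    equal.\<close>
  also have "(a - b) * (1 / a) + b * c = 2 * ((a - b) / a)"
    using pos by (simp add: c_def field_simps)
  finally show ?thesis .
qed

end

text \<open>The first equation is one in \<open>[0, \<infinity>]\<close> and covers weights that are
  not summable over \<open>H - T\<close>. The inequality concerns finite non-zero norms, on which
  \<open>enn2real\<close> loses nothing.\<close>

theorem proposition8:
  fixes M :: "'a measure"
    and B :: "nat \<Rightarrow> 'b label set"
    and j k :: nat
    and \<Xi> :: "'xi set"
    and w :: "'xi \<Rightarrow> (nat \<Rightarrow> 'b label set) \<Rightarrow> real"
    and p :: "'xi \<Rightarrow> ('a \<times> 'b label) list \<Rightarrow> real"
    and H T :: "('xi \<times> (nat \<Rightarrow> 'b label set)) set"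
  defines "norm1 \<equiv> ms_L1_norm M B j k"
    and "f \<equiv> ms_GLMB j k w p"
  assumes "sigma_finite_measure M" and "diffuse M"
    and "j \<le> k"
    and "\<And>s. finite (B s)" and "\<And>s l. l \<in> B s \<Longrightarrow> fst l = s"
    and "countable \<Xi>"
    and "\<And>\<xi> I. \<xi> \<in> \<Xi> \<Longrightarrow> I \<in> label_seqs j k B \<Longrightarrow> 0 \<le> w \<xi> I"
    and "\<And>\<xi> I. \<xi> \<in> \<Xi> \<Longrightarrow> I \<in> label_seqs j k B \<Longrightarrow> \<not> trajectory_labels j k I \<Longrightarrow> w \<xi> I = 0"
    and "\<And>\<xi> l t. \<xi> \<in> \<Xi> \<Longrightarrow> l \<in> label_space B k \<Longrightarrow> t \<in> {traj_start j l..k} \<Longrightarrow>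
           prob_density (\<Pi>\<^sub>M i\<in>{traj_start j l..t}. M)
             (\<lambda>x. p \<xi> (map (\<lambda>i. (x i, l)) [traj_start j l..<Suc t]))"
    and "H \<subseteq> \<Xi> \<times> label_seqs j k B"
    and "ms_GLMB_converges M B j k w p H"
    and "T \<subseteq> H"
  shows "norm1 (\<lambda>X. f H X - f T X) = (\<Sum>\<^sub>\<infinity>(\<xi>, I)\<in>H - T. ennreal (w \<xi> I)) \<and>
    (norm1 (f H) \<noteq> 0 \<and> norm1 (f H) \<noteq> \<infinity> \<and> norm1 (f T) \<noteq> 0 \<and> norm1 (f T) \<noteq> \<infinity> \<longrightarrow>
      norm1 (\<lambda>X. f H X / enn2real (norm1 (f H)) - f T X / enn2real (norm1 (f T)))
        \<le> ennreal (2 * ((enn2real (norm1 (f H)) - enn2real (norm1 (f T))) / enn2real (norm1 (f H)))))"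
proof -
  interpret ms_GLMB_model M B j k \<Xi> w p
    using assms(3,4,6,8-11) by (rule ms_GLMB_model.intro)
  note H = assms(12) and conv = assms(13) and T = assms(14)
  have "countable (H - T)"
    using countable_hyps[OF H] by auto
  then have "norm1 (\<lambda>X. f H X - f T X) = (\<Sum>\<^sub>\<infinity>(\<xi>, I)\<in>H - T. ennreal (w \<xi> I))"
    unfolding norm1_def f_def
    by (simp add: ms_L1_norm_Diff[OF H conv T] infsum_ennreal_eq_nn_integral total_weight_def split_def)
  moreover have norms: "norm1 (f H) = total_weight H" "norm1 (f T) = total_weight T"
    unfolding norm1_def f_def using ms_L1_norm_eq_total_weight[OF H conv] T by auto
  moreover have "norm1 (\<lambda>X. f H X / enn2real (total_weight H) - f T X / enn2real (total_weight T)) \<le>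
      ennreal (2 * ((enn2real (total_weight H) - enn2real (total_weight T)) / enn2real (total_weight H)))"
    if "total_weight H \<noteq> 0" "total_weight H \<noteq> \<infinity>" "total_weight T \<noteq> 0" "total_weight T \<noteq> \<infinity>"
    unfolding norm1_def f_def
    using that
    by (intro ms_L1_norm_normalized_le[OF H conv T])
      (auto simp: less_top enn2real_positive_iff zero_less_iff_neq_zero)
  ultimately show ?thesis by simp
qed

end
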